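(* Let $n$ be a squarefree odd positive integer and let $m$ be a positive integer with $n\mid m$. Then $$\bigl|\operatorname{Hom}_{\mathrm{ring}}(\mathbb{Z}_m,\mathbb{Z}_n)\bigr|=1+\#\{\text{quadratic subfields of }\mathbb{Q}(\zeta_n)\}.$$
   Context: $\mathbb{Z}_k=\mathbb{Z}/k\mathbb{Z}$ as a ring. $\operatorname{Hom}_{\mathrm{ring}}(R,S)$ denotes the set of maps $f\colon R\to S$ with $f(a+b)=f(a)+f(b)$ and $f(ab)=f(a)f(b)$ for all $a,b\in R$; it is not required that $f(1_R)=1_S$. $\mathbb{Q}(\zeta_n)$ is the $n$-th cyclotomic field, and a quadratic subfield is a subfield of degree $2$ over $\mathbb{Q}$. *)

theory Defs
  imports
    Complex_Main
    "HOL-Library.FuncSet"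
    "HOL-Computational_Algebra.Computational_Algebra"
    "HOL-Algebra.IntRing"
    "HOL-Algebra.Generated_Fields"
    "HOL-Algebra.Embedded_Algebras"
    "HOL-Algebra.Algebraic_Closure_Type"
begin

(* In contrast to ring_hom, a map in rng_hom need not send one to one.  Maps are taken
   extensional, so that each map between the carriers is counted exactly once. *)
definition rng_hom ::
  "('a, 'm) ring_scheme \<Rightarrow> ('b, 'n) ring_scheme \<Rightarrow> ('a \<Rightarrow> 'b) set" where
  "rng_hom R S = {f \<in> carrier R \<rightarrow>\<^sub>E carrier S.
     \<forall>a\<in>carrier R. \<forall>b\<in>carrier R.
       f (a \<oplus>\<^bsub>R\<^esub> b) = f a \<oplus>\<^bsub>S\<^esub> f b \<and> f (a \<otimes>\<^bsub>R\<^esub> b) = f a \<otimes>\<^bsub>S\<^esub> f b}"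

abbreviation complex_ring :: "complex ring" where
  "complex_ring \<equiv> ring_of_type_algebra"

(* For n > 0 the number cis (2 * pi / n) = exp (2 * pi * i / n) is a primitive n-th root of unity. *)
definition cyclotomic_field :: "nat \<Rightarrow> complex set" where
  "cyclotomic_field n = generate_field complex_ring (\<rat> \<union> {cis (2 * pi / real n)})"

definition quadratic_subfields :: "complex set \<Rightarrow> complex set set" where
  "quadratic_subfields L =
     {K. subfield K complex_ring \<and> K \<subseteq> L \<and> ring.dimension complex_ring 2 \<rat> K}"

end

theory Submission
  imports Defs "HOL-Number_Theory.Number_Theory"
begin

text \<open>
Both sides are computed as powers of two, with exponent the number \<open>\<omega>\<close> of prime divisors
of \<open>n\<close>.

A multiplicative and additive map \<open>\<int>/m \<rightarrow> \<int>/n\<close> is determined by the image \<open>e\<close> of \<open>1\<close>, which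
is an idempotent; conversely \<open>x \<mapsto> e x\<close> is well defined because \<open>n\<close> divides \<open>m\<close>
(\<open>bij_betw_idempotents_rng_hom\<close>). Since \<open>n\<close> is squarefree, an idempotent is a free choice of
\<open>0\<close> or \<open>1\<close> modulo each prime divisor of \<open>n\<close>, so there are \<open>2 ^ \<omega>\<close> of them (\<open>card_idempotents\<close>).

On the field side, let \<open>\<zeta>\<close> be a primitive \<open>n\<close>-th root of unity. The rule \<open>\<zeta> \<mapsto> \<zeta> ^ k\<close>, for \<open>k\<close>
coprime to \<open>n\<close>, extends to an automorphism of \<open>\<rat>(\<zeta>)\<close>; this is the irreducibility of the cyclotomic
polynomial, in the form \<open>vanish_conjugate\<close>. Averaging over the automorphisms shows that
only rational numbers are fixed by all of them (\<open>fixed_rational\<close>). A quadratic subfield is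
\<open>\<rat>(\<alpha>)\<close> with \<open>\<alpha>\<^sup>2\<close> rational, so each automorphism sends \<open>\<alpha>\<close> to \<open>\<plusminus>\<alpha>\<close>, and the signs form a
character \<open>\<chi>\<close> of the unit group of \<open>\<int>/n\<close> with values \<open>\<plusminus>1\<close>, not identically \<open>1\<close>. Conversely, a Gauss
sum of \<open>\<chi>\<close> is an element on which the automorphisms act through \<open>\<chi>\<close>; one of these sums is
nonzero by Fourier inversion, and its square is rational. Two elements with the same
\<open>\<chi>\<close> differ by a rational factor, so quadratic subfields correspond bijectively to nonprincipal
quadratic characters (\<open>bij_betw_characters_quadratic_subfields\<close>).

Finally, as \<open>n\<close> is odd and squarefree, its quadratic characters are exactly the products of
Legendre symbols over the subsets of its prime divisors; there are \<open>2 ^ \<omega>\<close> of them, one of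
which is principal (\<open>card_nonprincipal_characters\<close>).
\<close>

hide_const (open) Divisibility.prime

section \<open>Conjugates of roots of unity\<close>

text \<open>
This part shows that a polynomial relation of a root of unity \<open>z\<close> of order dividing \<open>n\<close> is inherited by
\<open>z ^ k\<close> for every \<open>k\<close> coprime to \<open>n\<close>. The argument is in the style of Landau: \<open>g(z ^ q) - g(z) ^ q\<close> is a multiple of the prime
\<open>q\<close> in \<open>\<int>[z]\<close>, so \<open>g(z) = 0\<close> makes \<open>g(z ^ q)\<close> divisible by \<open>q\<close>; as only finitely many values
\<open>g(z ^ i)\<close> occur, a large \<open>q\<close> can divide one of them only if it is zero.
\<close>

definition ipoly :: "int poly \<Rightarrow> complex \<Rightarrow> complex" where
  "ipoly g z = poly (map_poly of_int g) z"

lemma ipoly_pCons [simp]: "ipoly (pCons a g) z = of_int a + z * ipoly g z"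
  by (simp add: ipoly_def map_poly_pCons)

lemma ipoly_0 [simp]: "ipoly 0 z = 0"
  by (simp add: ipoly_def)

lemma ipoly_add [simp]: "ipoly (f + g) z = ipoly f z + ipoly g z"
proof -
  have "map_poly of_int (f + g) = (map_poly of_int f + map_poly of_int g :: complex poly)"
    by (intro poly_eqI) (simp add: coeff_map_poly)
  then show ?thesis by (simp add: ipoly_def)
qed

lemma ipoly_smult [simp]: "ipoly (smult a g) z = of_int a * ipoly g z"
  by (induction g) (simp_all add: algebra_simps)

lemma ipoly_mult [simp]: "ipoly (f * g) z = ipoly f z * ipoly g z"
  by (induction f) (simp_all add: algebra_simps)

text \<open>
The freshman's dream with its error term made explicit, for use in the ring of integer polynomials,
where \<open>q\<close> is not zero.
\<close>

lemma freshman_remainder: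
  fixes a b :: "'a :: comm_ring_1"
  assumes "prime q"
  shows "(a + b) ^ q = a ^ q + b ^ q + of_nat q * (\<Sum>k=1..<q. of_nat ((q choose k) div q) * a ^ k * b ^ (q - k))"
proof -
  have q: "q > 1" using assms prime_gt_1_nat by blast
  have "(a + b) ^ q = (\<Sum>k\<le>q. of_nat (q choose k) * a ^ k * b ^ (q - k))"
    by (rule binomial_ring)
  also have "{..q} = insert 0 (insert q {1..<q})"
    using q by auto
  also have "(\<Sum>k\<in>insert 0 (insert q {1..<q}). of_nat (q choose k) * a ^ k * b ^ (q - k)) =
      b ^ q + (a ^ q + (\<Sum>k=1..<q. of_nat (q choose k) * a ^ k * b ^ (q - k)))"
    using q by simp
  also have "(\<Sum>k=1..<q. of_nat (q choose k) * a ^ k * b ^ (q - k)) =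
     of_nat q * (\<Sum>k=1..<q. of_nat ((q choose k) div q) * a ^ k * b ^ (q - k))"
    unfolding sum_distrib_left
  proof (rule sum.cong[OF refl])
    fix k assume "k \<in> {1..<q}"
    then have "q dvd (q choose k)"
      using assms by (intro dvd_choose_prime) auto
    then have "(of_nat (q choose k) :: 'a) = of_nat q * of_nat ((q choose k) div q)"
      by (metis dvd_mult_div_cancel of_nat_mult)
    then show "of_nat (q choose k) * a ^ k * b ^ (q - k) =
       of_nat q * (of_nat ((q choose k) div q) * a ^ k * b ^ (q - k))"
      by (simp add: mult.assoc)
  qed
  finally show ?thesis by (simp add: algebra_simps)
qed

lemma fermat_int:
  fixes c :: int
  assumes "prime q"
  shows "int q dvd c ^ q - c"
proof -
  define a where "a = nat (c mod int q)"
  have q: "q > 1" using assms prime_gt_1_nat by blast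
  have ac: "[c = int a] (mod int q)"
    using q by (simp add: a_def cong_def)
  have "[a ^ q = a] (mod q)"
  proof (cases "q dvd a")
    case True
    then show ?thesis using q
      by (metis cong_0_iff cong_sym cong_trans dvd_power dvd_trans not_less_zero gr0I)
  next
    case False
    then have "[a ^ (q - 1) * a = 1 * a] (mod q)"
      using assms by (intro cong_scalar_right fermat_theorem)
    then show ?thesis using q by (metis mult_1 power_minus_mult zero_less_one less_trans)
  qed
  then have "[int a ^ q = int a] (mod int q)"
    by (metis cong_int_iff of_nat_power)
  then have "[c ^ q = c] (mod int q)"
    by (meson ac cong_pow cong_sym cong_trans)
  then show ?thesis by (simp add: cong_iff_dvd_diff)
qed

text \<open>
The remainder \<open>h\<close> must be one polynomial for all \<open>z\<close>: later \<open>z\<close> runs through powers of a root of unity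
and \<open>h\<close> of any of them has to stay in the ring generated by that root.
\<close>

lemma ipoly_frobenius:
  assumes "prime q"
  shows "\<exists>h. \<forall>z. ipoly g (z ^ q) = ipoly g z ^ q + of_nat q * ipoly h z"
proof (induction g)
  case 0
  show ?case using assms prime_gt_0_nat by (intro exI[of _ 0]) (auto simp: power_0_left)
next
  case (pCons c g)
  then obtain h where h: "\<And>z. ipoly g (z ^ q) = ipoly g z ^ q + of_nat q * ipoly h z"
    by blast
  obtain e where e: "c ^ q - c = int q * e"
    using fermat_int[OF assms] by (auto elim: dvdE)
  define r :: "int poly" where
    "r = (\<Sum>k=1..<q. of_nat ((q choose k) div q) * [:c:] ^ k * pCons 0 g ^ (q - k))"
  have pw: "[:c:] ^ q = [:c ^ q:]" for q :: nat
    by (induction q) (auto simp: one_pCons)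
  have "pCons c g ^ q = ([:c:] + pCons 0 g) ^ q"
    by simp
  also have "\<dots> = [:c:] ^ q + pCons 0 g ^ q + of_nat q * r"
    unfolding r_def by (rule freshman_remainder[OF assms])
  finally have A: "pCons c g ^ q = [:c ^ q:] + pCons 0 g ^ q + of_nat q * r"
    by (simp add: pw)
  have ip: "ipoly (f ^ k) z = ipoly f z ^ k" for f k z
    by (induction k) (auto simp: one_pCons)
  have on: "ipoly (of_nat k * f) z = of_nat k * ipoly f z" for k f z
    by (simp add: of_nat_poly)
  have on1: "ipoly (of_nat k) z = of_nat k" for k z
    by (simp add: of_nat_poly)
  have "ipoly (pCons c g) (z ^ q) = ipoly (pCons c g) z ^ q
      + of_nat q * ipoly (monom 1 q * h - r - [:e:]) z" for z
  proof -
    have p: "ipoly (pCons c g) z ^ q = of_int (c ^ q) + (z * ipoly g z) ^ q + of_nat q * ipoly r z"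
      using arg_cong[OF A, of "\<lambda>f. ipoly f z"] by (simp add: ip on on1 del: ipoly_pCons) (simp add: ip on)
    have c: "of_int (c ^ q) = (of_int c + of_nat q * of_int e :: complex)"
      using e by (metis add_diff_cancel_left' diff_add_cancel of_int_add of_int_mult of_int_of_nat_eq add.commute)
    have r: "ipoly (monom 1 q * h - r - [:e:]) z = z ^ q * ipoly h z - ipoly r z - of_int e"
    proof -
      have m: "ipoly (- f) z = - ipoly f z" for f
        by (metis ipoly_smult of_int_minus of_int_1 mult_minus1 smult_1_left smult_minus_left)
      have "ipoly (monom 1 q) z = z ^ q"
        by (simp add: ipoly_def map_poly_monom poly_monom)
      then show ?thesis
        by (simp only: diff_conv_add_uminus ipoly_add ipoly_mult m) simp
    qed
    show ?thesis
      unfolding p c r by (simp add: h power_mult_distrib algebra_simps)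
  qed
  then show ?case by blast
qed

text \<open>
The complex numbers form a rational vector space, in which a nonzero vector extends to a basis.
Such functionals play the role of coordinates with respect to a basis of \<open>\<rat>(z)\<close>.
\<close>

lemma rational_functional:
  fixes b :: complex
  assumes "b \<noteq> 0"
  obtains \<phi> :: "complex \<Rightarrow> rat" where "\<And>x y. \<phi> (x + y) = \<phi> x + \<phi> y"
    "\<And>r x. \<phi> (of_rat r * x) = r * \<phi> x" "\<phi> b = 1"
proof -
  interpret C: vector_space "\<lambda>(r::rat) (x::complex). of_rat r * x"
    by standard (auto simp: of_rat_add of_rat_mult algebra_simps)
  interpret Q: vector_space "\<lambda>(r::rat) (x::rat). r * x"
    by standard (auto simp: algebra_simps)
  interpret CQ: vector_space_pair "\<lambda>(r::rat) (x::complex). of_rat r * x" "\<lambda>(r::rat) (x::rat). r * x" ..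
  have ind: "C.independent {b}"
    using assms by simp
  show ?thesis
  proof (rule that[of "CQ.construct {b} (\<lambda>_. 1)"])
    interpret L: Vector_Spaces.linear "\<lambda>(r::rat) (x::complex). of_rat r * x" "\<lambda>(r::rat) (x::rat). r * x"
      "CQ.construct {b} (\<lambda>_. 1)"
      by (rule CQ.linear_construct[OF ind])
    show "CQ.construct {b} (\<lambda>_. 1) (x + y) = CQ.construct {b} (\<lambda>_. 1) x + CQ.construct {b} (\<lambda>_. 1) y" for x y
      by (rule L.add)
    show "CQ.construct {b} (\<lambda>_. 1) (of_rat r * x) = r * CQ.construct {b} (\<lambda>_. 1) x" for r x
      by (rule L.scale)
    show "CQ.construct {b} (\<lambda>_. 1) b = 1"
      by (rule CQ.construct_basis[OF ind]) simp
  qed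
qed

lemma power_mod_root_of_unity:
  fixes z :: complex
  assumes "z ^ n = 1"
  shows "z ^ (i mod n) = z ^ i"
proof -
  have "z ^ i = z ^ (n * (i div n) + i mod n)" by simp
  also have "\<dots> = z ^ (i mod n)" using assms by (simp only: power_add power_mult) simp
  finally show ?thesis by simp
qed

text \<open>
A nonzero number has only finitely many divisors \<open>q\<close> among the positive integers in \<open>\<int>[z]\<close>: a functional
with \<open>\<phi>(b) = 1\<close> takes values with bounded denominator on \<open>\<int>[z]\<close>, since that group is generated by
the finitely many powers of \<open>z\<close>. If \<open>D\<close> is a common denominator, then \<open>b = q h(z)\<close> forces \<open>q\<close> to
divide \<open>D\<close>.
\<close>

lemma bounded_divisors:
  fixes z b :: complex
  assumes "n > 0" "z ^ n = 1" "b \<noteq> 0"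
  shows "\<exists>B. \<forall>q>B. \<forall>h. b \<noteq> of_nat q * ipoly h z"
proof -
  obtain \<phi> :: "complex \<Rightarrow> rat" where add: "\<And>x y. \<phi> (x + y) = \<phi> x + \<phi> y"
    and scale: "\<And>r x. \<phi> (of_rat r * x) = r * \<phi> x" and b1: "\<phi> b = 1"
    using rational_functional[OF \<open>b \<noteq> 0\<close>] by metis
  define D where "D = (\<Prod>j<n. snd (quotient_of (\<phi> (z ^ j))))"
  have D0: "D > 0"
    unfolding D_def by (intro prod_pos) (auto simp: quotient_of_denom_pos')
  have Dj: "of_int D * \<phi> (z ^ j) \<in> \<int>" for j
  proof -
    let ?k = "j mod n"
    define c where "c = \<phi> (z ^ ?k)"
    have "?k < n" using \<open>n > 0\<close> by simp
    then have "snd (quotient_of c) dvd D"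
      unfolding D_def c_def by (intro dvd_prodI) auto
    then obtain e where e: "D = snd (quotient_of c) * e" by (elim dvdE)
    have "of_int D * c = of_int (e * fst (quotient_of c))"
      using quotient_of_div[of c "fst (quotient_of c)" "snd (quotient_of c)"] quotient_of_denom_pos'[of c]
      by (simp add: e) (metis (no_types, lifting) nonzero_mult_div_cancel_left of_int_0_eq_iff order_less_irrefl times_divide_eq_right mult.commute)
    moreover have "c = \<phi> (z ^ j)" unfolding c_def power_mod_root_of_unity[OF assms(2)] ..
    ultimately show ?thesis by (metis Ints_of_int)
  qed
  have \<phi>0: "\<phi> 0 = 0" using scale[of 0 0] by simp
  have Dint: "of_int D * \<phi> (ipoly h z * z ^ i) \<in> \<int>" for h i
  proof (induction h arbitrary: i)
    case 0
    then show ?case by (simp add: \<phi>0)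
  next
    case (pCons a h)
    have "\<phi> (ipoly (pCons a h) z * z ^ i) = \<phi> (of_rat (of_int a) * z ^ i) + \<phi> (ipoly h z * z ^ Suc i)"
      by (simp add: algebra_simps flip: add)
    also have "\<phi> (of_rat (of_int a) * z ^ i) = of_int a * \<phi> (z ^ i)" by (rule scale)
    finally have "of_int D * \<phi> (ipoly (pCons a h) z * z ^ i) = of_int a * (of_int D * \<phi> (z ^ i)) + of_int D * \<phi> (ipoly h z * z ^ Suc i)"
      by (simp add: algebra_simps)
    then show ?case using Dj pCons.IH[of "Suc i"] by (auto intro!: Ints_add Ints_mult)
  qed
  show ?thesis
  proof (intro exI[of _ "nat D"] allI impI notI)
    fix q h assume q: "nat D < q" and bq: "b = of_nat q * ipoly h z"
    have "b = of_rat (of_nat q) * ipoly h z" using bq by simp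
    then have "1 = of_nat q * \<phi> (ipoly h z)" using scale b1 by metis
    then have "of_int D = of_nat q * (of_int D * \<phi> (ipoly h z))"
      by (metis mult.left_commute mult.right_neutral)
    moreover obtain e where "of_int D * \<phi> (ipoly h z) = of_int e"
      using Dint[of h 0] by (auto elim: Ints_cases)
    ultimately have "(of_int D :: rat) = of_int (int q * e)" by simp
    then have "D = int q * e" using of_int_eq_iff by blast
    then have "int q \<le> D" using D0 by (metis dvd_triv_left zdvd_imp_le)
    then show False using q D0 by linarith
  qed
qed

text \<open>
The bound may be chosen independently of \<open>i\<close> because \<open>g(z ^ i)\<close> depends only on \<open>i mod n\<close>. This
uniformity lets the step be iterated over the prime factors of an exponent.
\<close>

lemma vanish_large_primes:
  fixes z :: complex
  assumes "n > 0" "z ^ n = 1"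
  shows "\<exists>B. \<forall>q>B. prime q \<longrightarrow> (\<forall>i. ipoly g (z ^ i) = 0 \<longrightarrow> ipoly g (z ^ (i * q)) = 0)"
proof -
  have "\<forall>j\<in>{..<n}. \<exists>B. ipoly g (z ^ j) \<noteq> 0 \<longrightarrow> (\<forall>q>B. \<forall>h. ipoly g (z ^ j) \<noteq> of_nat q * ipoly h z)"
    using bounded_divisors[OF assms] by blast
  then obtain B where B: "\<And>j q h. j < n \<Longrightarrow> ipoly g (z ^ j) \<noteq> 0 \<Longrightarrow> q > B j \<Longrightarrow> ipoly g (z ^ j) \<noteq> of_nat q * ipoly h z"
    by (metis lessThan_iff)
  have "ipoly g (z ^ (i * q)) = 0"
    if q: "q > (\<Sum>j<n. B j)" "prime q" and i: "ipoly g (z ^ i) = 0" for q i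
  proof (rule ccontr)
    assume neq: "ipoly g (z ^ (i * q)) \<noteq> 0"
    define j where "j = i * q mod n"
    have zj: "z ^ j = z ^ (i * q)"
      unfolding j_def by (rule power_mod_root_of_unity[OF assms(2)])
    have j: "j < n" using assms by (simp add: j_def)
    obtain h where h: "\<And>w. ipoly g (w ^ q) = ipoly g w ^ q + of_nat q * ipoly h w"
      using ipoly_frobenius[OF \<open>prime q\<close>] by blast
    have "ipoly g (z ^ (i * q)) = of_nat q * ipoly h (z ^ i)"
      using h[of "z ^ i"] i q(2) prime_gt_0_nat by (simp add: power_mult power_0_left)
    also have "ipoly h (z ^ i) = ipoly (h \<circ>\<^sub>p monom 1 i) z"
    proof (induction h)
      case (pCons a h)
      have "ipoly (monom 1 i) z = z ^ i"
        by (simp add: ipoly_def map_poly_monom poly_monom)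
      then show ?case using pCons by (simp add: pcompose_pCons)
    qed simp
    finally have "ipoly g (z ^ j) = of_nat q * ipoly (h \<circ>\<^sub>p monom 1 i) z" by (simp add: zj)
    moreover have "B j \<le> (\<Sum>j<n. B j)" using j by (intro member_le_sum) auto
    ultimately show False using B[OF j, of q] neq q zj by force
  qed
  then show ?thesis by blast
qed

text \<open>
By the Chinese remainder theorem \<open>k\<close> can be replaced by some \<open>l\<close> congruent to it modulo \<open>n\<close> all of
whose prime factors are large: it suffices to make \<open>l\<close> congruent to \<open>1\<close> modulo the small primes that do not
divide \<open>n\<close>, since those dividing \<open>n\<close> cannot divide a number coprime to it. Then \<open>l\<close> is reached from \<open>1\<close> by multiplying with large primes.
\<close>

lemma vanish_conjugate_int:
  fixes z :: complex
  assumes "n > 0" "z ^ n = 1" "coprime k n" "ipoly g z = 0"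
  shows "ipoly g (z ^ k) = 0"
proof -
  obtain B where B: "\<And>q i. q > B \<Longrightarrow> prime q \<Longrightarrow> ipoly g (z ^ i) = 0 \<Longrightarrow> ipoly g (z ^ (i * q)) = 0"
    using vanish_large_primes[OF assms(1,2), of g] by blast
  define N where "N = (\<Prod>p | prime p \<and> p \<le> B \<and> \<not> p dvd n. p)"
  have fin: "finite {p. prime p \<and> p \<le> B \<and> \<not> p dvd n}" by simp
  have "coprime n N"
    unfolding N_def by (intro prod_coprime_right) (auto intro: prime_imp_coprime simp: coprime_commute)
  then obtain l where l: "[l = k] (mod n)" "[l = 1] (mod N)"
    using binary_chinese_remainder_nat by blast
  have cop: "coprime l n"
    using l(1) assms(3) coprime_cong_cong_left by blast
  have big: "q > B" if "prime q" "q dvd l" for q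
  proof (rule ccontr)
    assume "\<not> q > B"
    show False
    proof (cases "q dvd n")
      case True
      then show ?thesis using cop that by (meson coprime_common_divisor not_prime_unit)
    next
      case False
      then have "q dvd N" unfolding N_def using fin that \<open>\<not> q > B\<close> by (intro dvd_prodI) auto
      moreover have "coprime l N" using l(2) by (metis cong_sym coprime_1_left coprime_cong_cong_left)
      ultimately show ?thesis using that by (meson coprime_common_divisor not_prime_unit)
    qed
  qed
  have "ipoly g (z ^ (i * l)) = 0" if "l > 0" "\<And>q. prime q \<Longrightarrow> q dvd l \<Longrightarrow> q > B" "ipoly g (z ^ i) = 0" for l i
    using that
  proof (induction l arbitrary: i rule: less_induct)
    case (less l)
    show ?case
    proof (cases "l = 1")
      case True
      then show ?thesis using less.prems by simp
    next
      case False
      then obtain q where q: "prime q" "q dvd l" using prime_factor_nat by blast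
      then obtain m where m: "l = q * m" by (elim dvdE)
      have "ipoly g (z ^ (i * q)) = 0"
        using less.prems q by (intro B) auto
      moreover have "m > 0" using m less.prems(1) by simp
      moreover have "m < l" using m \<open>m > 0\<close> prime_gt_1_nat[OF q(1)] by simp
      ultimately have "ipoly g (z ^ (i * q * m)) = 0"
        using less.prems m by (intro less.IH[of m "i * q"]) auto
      then show ?thesis by (simp add: m mult.assoc)
    qed
  qed
  from this[of l 1] have "l > 0 \<Longrightarrow> ipoly g (z ^ l) = 0" using big assms(4) by simp
  moreover have "z ^ l = z ^ k"
    using l(1) power_mod_root_of_unity[OF assms(2)] by (metis cong_def)
  \<comment> \<open>The representative \<open>l = 0\<close> can only arise for \<open>n = 1\<close>, where the claim is trivial.\<close>
  moreover have "z ^ l = z" if "l = 0"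
  proof -
    have "n = 1" using cop that by simp
    then show ?thesis using assms that by simp
  qed
  ultimately show ?thesis using assms(4) by (metis gr0I)
qed

definition rpoly :: "rat poly \<Rightarrow> complex \<Rightarrow> complex" where
  "rpoly P z = poly (map_poly of_rat P) z"

lemma rpoly_pCons [simp]: "rpoly (pCons a P) z = of_rat a + z * rpoly P z"
  by (simp add: rpoly_def map_poly_pCons)

lemma rpoly_0 [simp]: "rpoly 0 z = 0"
  by (simp add: rpoly_def)

lemma rpoly_add [simp]: "rpoly (P + Q) z = rpoly P z + rpoly Q z"
proof -
  have "map_poly of_rat (P + Q) = (map_poly of_rat P + map_poly of_rat Q :: complex poly)"
    by (intro poly_eqI) (simp add: coeff_map_poly of_rat_add)
  then show ?thesis by (simp add: rpoly_def)
qed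

lemma rpoly_smult [simp]: "rpoly (smult a P) z = of_rat a * rpoly P z"
  by (induction P) (simp_all add: of_rat_mult algebra_simps)

lemma rpoly_minus [simp]: "rpoly (- P) z = - rpoly P z"
  using rpoly_smult[of "-1" P z] by (simp add: of_rat_minus)

lemma rpoly_mult [simp]: "rpoly (P * Q) z = rpoly P z * rpoly Q z"
  by (induction P) (simp_all add: algebra_simps)

lemma rpoly_monom [simp]: "rpoly (monom 1 k) z = z ^ k"
  by (simp add: rpoly_def map_poly_monom poly_monom)

lemma rpoly_pcompose_monom: "rpoly (P \<circ>\<^sub>p monom 1 k) z = rpoly P (z ^ k)"
  by (induction P) (simp_all add: pcompose_pCons)

lemma clear_denominators: "\<exists>d>0. \<exists>g. \<forall>z. ipoly g z = of_int d * rpoly P z"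
proof (induction P)
  case 0
  show ?case by (intro exI[of _ 1] conjI exI[of _ 0]) auto
next
  case (pCons a P)
  then obtain d g where d: "d > 0" and g: "\<And>z. ipoly g z = of_int d * rpoly P z" by blast
  obtain u v where uv: "quotient_of a = (u, v)" by force
  then have v: "v > 0" and a: "a = of_int u / of_int v"
    using quotient_of_denom_pos quotient_of_div by auto
  have "of_rat a = (of_int u / of_int v :: complex)"
    by (simp add: a of_rat_divide)
  then have "ipoly (pCons (d * u) (smult v g)) z = of_int (d * v) * rpoly (pCons a P) z" for z
    using v by (simp add: g algebra_simps)
  then show ?case using d v by (metis mult_pos_pos)
qed

lemma vanish_conjugate:
  fixes z :: complex
  assumes "n > 0" "z ^ n = 1" "coprime k n" "rpoly P z = 0"
  shows "rpoly P (z ^ k) = 0"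
proof -
  obtain d g where "d > 0" and g: "\<And>z. ipoly g z = of_int d * rpoly P z"
    using clear_denominators by blast
  then show ?thesis
    using vanish_conjugate_int[OF assms(1-3), of g] assms(4) by simp
qed

lemma sum_root_of_unity:
  fixes w :: complex
  assumes "w ^ e = 1"
  shows "(\<Sum>j<e. w ^ j) = (if w = 1 then of_nat e else 0)"
  using assms by (simp add: sum_gp_strict)

section \<open>The conjugation maps of a cyclotomic field\<close>

text \<open>
For \<open>S\<close> the set of prime divisors of \<open>n\<close> and \<open>d = 1\<close> this is a Ramanujan sum, so the lemma says that
traces of roots of unity are rational. The general form allows a proof by sieving: removing the
multiples of one more \<open>p\<close> subtracts the sum with \<open>d\<close> replaced by \<open>lcm d p\<close>, and for empty \<open>S\<close>
the sum is geometric.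
\<close>

lemma sum_sifted_powers_rational:
  fixes w :: complex
  assumes "finite S" "n > 0" "w ^ n = 1" "\<And>p. p \<in> S \<Longrightarrow> p dvd n" "d dvd n"
  shows "(\<Sum>k | k < n \<and> d dvd k \<and> (\<forall>p\<in>S. \<not> p dvd k). w ^ k) \<in> \<rat>"
  using assms(1,4,5)
proof (induction S arbitrary: d rule: finite_induct)
  case empty
  then obtain e where e: "n = d * e" by (auto elim: dvdE)
  then have "d > 0" using assms(2) by simp
  then have "{k. k < n \<and> d dvd k} = (\<lambda>j. d * j) ` {..<e}"
    by (auto simp: e elim!: dvdE)
  moreover have "inj_on (\<lambda>j. d * j) {..<e}" using \<open>d > 0\<close> by (intro inj_onI) simp
  ultimately have "(\<Sum>k | k < n \<and> d dvd k. w ^ k) = (\<Sum>j<e. (w ^ d) ^ j)"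
    by (simp add: sum.reindex power_mult)
  also have "\<dots> \<in> \<rat>"
    using assms(3) by (subst sum_root_of_unity) (auto simp: e power_mult)
  finally show ?case by simp
next
  case (insert p S)
  have *: "{k. k < n \<and> d dvd k \<and> (\<forall>p\<in>S. \<not> p dvd k)} =
      {k. k < n \<and> d dvd k \<and> (\<forall>p\<in>insert p S. \<not> p dvd k)} \<union>
      {k. k < n \<and> lcm d p dvd k \<and> (\<forall>p\<in>S. \<not> p dvd k)}" by auto
  have split: "(\<Sum>k | k < n \<and> d dvd k \<and> (\<forall>p\<in>S. \<not> p dvd k). w ^ k) =
      (\<Sum>k | k < n \<and> d dvd k \<and> (\<forall>p\<in>insert p S. \<not> p dvd k). w ^ k) +
      (\<Sum>k | k < n \<and> lcm d p dvd k \<and> (\<forall>p\<in>S. \<not> p dvd k). w ^ k)"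
    unfolding * by (rule sum.union_disjoint) auto
  have "(\<Sum>k | k < n \<and> d dvd k \<and> (\<forall>p\<in>S. \<not> p dvd k). w ^ k) \<in> \<rat>"
    using insert by auto
  moreover have "(\<Sum>k | k < n \<and> lcm d p dvd k \<and> (\<forall>p\<in>S. \<not> p dvd k). w ^ k) \<in> \<rat>"
    using insert.prems by (intro insert.IH) (auto intro: lcm_least)
  ultimately have "(\<Sum>k | k < n \<and> d dvd k \<and> (\<forall>p\<in>S. \<not> p dvd k). w ^ k) -
      (\<Sum>k | k < n \<and> lcm d p dvd k \<and> (\<forall>p\<in>S. \<not> p dvd k). w ^ k) \<in> \<rat>"
    by (rule Rats_diff)
  then show ?case by (simp only: split add_diff_cancel_right')
qed

lemma coprime_iff_no_prime_factor:
  fixes n :: nat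
  assumes "n > 0"
  shows "coprime k n \<longleftrightarrow> (\<forall>p\<in>prime_factors n. \<not> p dvd k)"
proof
  assume "coprime k n"
  then show "\<forall>p\<in>prime_factors n. \<not> p dvd k"
    by (meson coprime_common_divisor in_prime_factors_iff not_prime_unit)
next
  assume *: "\<forall>p\<in>prime_factors n. \<not> p dvd k"
  show "coprime k n"
  proof (rule ccontr)
    assume "\<not> coprime k n"
    then have "gcd k n \<noteq> 1" using coprime_iff_gcd_eq_1 by blast
    then obtain p where "prime p" "p dvd gcd k n" using prime_factor_nat[of "gcd k n"] by auto
    then show False using * assms by (auto simp: in_prime_factors_iff)
  qed
qed

locale primitive_root_of_unity =
  fixes n :: nat and \<zeta> :: complex
  assumes n_pos: "n > 0" and root_iff: "\<And>j. \<zeta> ^ j = 1 \<longleftrightarrow> n dvd j"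
begin

lemma root_n: "\<zeta> ^ n = 1"
  by (simp add: root_iff)

lemma power_cong: "[i = j] (mod n) \<Longrightarrow> \<zeta> ^ i = \<zeta> ^ j"
  by (metis cong_def power_mod_root_of_unity[OF root_n])

definition units :: "nat set" where
  "units = {k. k < n \<and> coprime k n}"

lemma finite_units [simp]: "finite units"
  by (simp add: units_def)

lemma one_mod_unit: "1 mod n \<in> units"
  using n_pos by (simp add: units_def coprime_mod_left_iff)

lemma units_mult_bij:
  assumes "coprime l n"
  shows "bij_betw (\<lambda>k. k * l mod n) units units"
proof -
  have "inj_on (\<lambda>k. k * l mod n) units"
  proof (rule inj_onI)
    fix a b assume "a \<in> units" "b \<in> units" "a * l mod n = b * l mod n"
    moreover from this have "[a = b] (mod n)"
      using cong_mult_rcancel_nat[OF assms] by (simp add: cong_def)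
    ultimately show "a = b"
      by (simp add: units_def cong_def)
  qed
  moreover have "(\<lambda>k. k * l mod n) ` units \<subseteq> units"
    using assms n_pos by (auto simp: units_def coprime_mod_left_iff)
  ultimately show ?thesis
    by (simp add: bij_betw_def endo_inj_surj)
qed

lemma unit_inverse:
  assumes "coprime k n"
  obtains l where "coprime l n" "[k * l = 1] (mod n)"
proof -
  obtain l where l: "[k * l = 1] (mod n)"
    using cong_solve_coprime_nat[OF assms] by auto
  then have "coprime (k * l) n"
    using coprime_cong_cong_left[OF l] by simp
  then show ?thesis using that[of l] l by simp
qed

text \<open>
The ring \<open>\<rat>[\<zeta>]\<close>. It turns out to be the cyclotomic field once inverses have been
constructed by means of the conjugation maps, see \<open>L_inverse\<close>.
\<close>

definition L :: "complex set" where
  "L = range (\<lambda>P. rpoly P \<zeta>)"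

text \<open>
The automorphism with \<open>\<zeta> \<mapsto> \<zeta> ^ k\<close>. That the chosen representing polynomial does not matter is
\<open>conj_rpoly\<close>, which rests on \<open>vanish_conjugate\<close> and therefore needs \<open>k\<close> coprime to \<open>n\<close>.
\<close>

definition conj :: "nat \<Rightarrow> complex \<Rightarrow> complex" where
  "conj k x = rpoly (SOME P. rpoly P \<zeta> = x) (\<zeta> ^ k)"

lemma conj_rpoly:
  assumes "coprime k n"
  shows "conj k (rpoly P \<zeta>) = rpoly P (\<zeta> ^ k)"
proof -
  define Q where "Q = (SOME Q. rpoly Q \<zeta> = rpoly P \<zeta>)"
  have "rpoly Q \<zeta> = rpoly P \<zeta>"
    unfolding Q_def by (rule someI[of _ P]) simp
  then have "rpoly (Q + - P) \<zeta> = 0" by (simp only: rpoly_add rpoly_minus) simp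
  then have "rpoly (Q + - P) (\<zeta> ^ k) = 0"
    by (rule vanish_conjugate[OF n_pos root_n assms])
  then have "rpoly Q (\<zeta> ^ k) = rpoly P (\<zeta> ^ k)"
    by (simp only: rpoly_add rpoly_minus) simp
  then show ?thesis by (simp add: conj_def Q_def)
qed

lemma L_E: assumes "x \<in> L" obtains P where "x = rpoly P \<zeta>"
  using assms by (auto simp: L_def)

lemma L_rpoly [simp]: "rpoly P \<zeta> \<in> L"
  by (simp add: L_def)

lemma L_rat: "x \<in> \<rat> \<Longrightarrow> x \<in> L"
  using L_rpoly[of "[:r:]" for r] by (auto elim!: Rats_cases)

lemma L_add: "x \<in> L \<Longrightarrow> y \<in> L \<Longrightarrow> x + y \<in> L"
  by (metis L_E L_rpoly rpoly_add)

lemma L_mult: "x \<in> L \<Longrightarrow> y \<in> L \<Longrightarrow> x * y \<in> L"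
  by (metis L_E L_rpoly rpoly_mult)

lemma L_minus: "x \<in> L \<Longrightarrow> - x \<in> L"
  by (metis L_E L_rpoly rpoly_minus)

lemma L_power: "\<zeta> ^ k \<in> L"
  by (metis L_rpoly rpoly_monom)

lemma L_sum: "(\<And>a. a \<in> A \<Longrightarrow> f a \<in> L) \<Longrightarrow> sum f A \<in> L"
  by (induction A rule: infinite_finite_induct) (auto intro: L_add L_rat)

lemma L_prod: "(\<And>a. a \<in> A \<Longrightarrow> f a \<in> L) \<Longrightarrow> prod f A \<in> L"
  by (induction A rule: infinite_finite_induct) (auto intro: L_mult L_rat)

lemma conj_L: "coprime k n \<Longrightarrow> x \<in> L \<Longrightarrow> conj k x \<in> L"
  by (metis L_E L_rpoly conj_rpoly rpoly_pcompose_monom)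

lemma conj_rat: "coprime k n \<Longrightarrow> x \<in> \<rat> \<Longrightarrow> conj k x = x"
  using conj_rpoly[of k "[:r:]" for r] by (auto elim!: Rats_cases)

lemma conj_add: "coprime k n \<Longrightarrow> x \<in> L \<Longrightarrow> y \<in> L \<Longrightarrow> conj k (x + y) = conj k x + conj k y"
  by (metis L_E conj_rpoly rpoly_add)

lemma conj_mult: "coprime k n \<Longrightarrow> x \<in> L \<Longrightarrow> y \<in> L \<Longrightarrow> conj k (x * y) = conj k x * conj k y"
  by (metis L_E conj_rpoly rpoly_mult)

lemma conj_power: "coprime k n \<Longrightarrow> conj k (\<zeta> ^ i) = \<zeta> ^ (i * k)"
  using conj_rpoly[of k "monom 1 i"] by (simp add: mult.commute flip: power_mult)

lemma conj_sum:
  assumes "coprime k n" "\<And>a. a \<in> A \<Longrightarrow> f a \<in> L"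
  shows "conj k (sum f A) = (\<Sum>a\<in>A. conj k (f a))"
  using assms(2)
  by (induction A rule: infinite_finite_induct) (auto simp: conj_add conj_rat assms(1) L_sum)

lemma conj_prod:
  assumes "coprime k n" "\<And>a. a \<in> A \<Longrightarrow> f a \<in> L"
  shows "conj k (prod f A) = (\<Prod>a\<in>A. conj k (f a))"
  using assms(2)
  by (induction A rule: infinite_finite_induct) (auto simp: conj_mult conj_rat assms(1) L_prod)

lemma conj_cong: "[k = l] (mod n) \<Longrightarrow> conj k x = conj l x"
  using power_cong[of k l] by (simp add: conj_def)

lemma conj_conj:
  assumes "coprime k n" "coprime l n" "x \<in> L"
  shows "conj k (conj l x) = conj (k * l) x"
proof -
  obtain P where P: "x = rpoly P \<zeta>" using assms(3) by (rule L_E)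
  have "conj k (conj l x) = conj k (rpoly (P \<circ>\<^sub>p monom 1 l) \<zeta>)"
    by (simp add: P conj_rpoly assms rpoly_pcompose_monom)
  also have "\<dots> = rpoly P (\<zeta> ^ (k * l))"
    unfolding conj_rpoly[OF assms(1)] by (simp only: rpoly_pcompose_monom power_mult)
  also have "\<dots> = conj (k * l) x"
    using assms by (simp add: P conj_rpoly)
  finally show ?thesis .
qed

lemma conj_one: "x \<in> L \<Longrightarrow> conj 1 x = x"
  by (metis L_E conj_rpoly coprime_1_left power_one_right)

lemma conj_eq_0:
  assumes "coprime k n" "x \<in> L" "conj k x = 0"
  shows "x = 0"
proof -
  obtain l where l: "coprime l n" "[k * l = 1] (mod n)"
    using unit_inverse[OF assms(1)] .
  have "x = conj (l * k) x"
    using conj_cong[OF l(2), of x] conj_one[OF assms(2)] by (simp add: mult.commute)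
  also have "\<dots> = conj l (conj k x)"
    using conj_conj[OF l(1) assms(1,2)] by simp
  also have "\<dots> = 0" by (simp add: assms(3) conj_rat l(1))
  finally show ?thesis .
qed

lemma trace_power_rational: "(\<Sum>k\<in>units. (\<zeta> ^ i) ^ k) \<in> \<rat>"
proof -
  have "units = {k. k < n \<and> 1 dvd k \<and> (\<forall>p\<in>prime_factors n. \<not> p dvd k)}"
    using coprime_iff_no_prime_factor[OF n_pos] by (auto simp: units_def)
  moreover have "(\<zeta> ^ i) ^ n = 1" by (simp add: root_iff flip: power_mult)
  ultimately show ?thesis
    using n_pos by (simp only:) (rule sum_sifted_powers_rational, auto)
qed

text \<open>
An element fixed by all conjugations equals the average of its conjugates, and
this average is rational because the conjugates of each power of \<open>\<zeta>\<close> have a rational sum.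
\<close>

lemma fixed_rational:
  assumes "x \<in> L" "\<And>k. coprime k n \<Longrightarrow> conj k x = x"
  shows "x \<in> \<rat>"
proof -
  obtain P where P: "x = rpoly P \<zeta>" using assms(1) by (rule L_E)
  \<comment> \<open>The extra factor \<open>(\<zeta> ^ i) ^ k\<close> carries the induction over the coefficients of \<open>P\<close>.\<close>
  have tr: "(\<Sum>k\<in>units. (\<zeta> ^ i) ^ k * rpoly P (\<zeta> ^ k)) \<in> \<rat>" for i
  proof (induction P arbitrary: i)
    case (pCons a P)
    have "(\<Sum>k\<in>units. (\<zeta> ^ i) ^ k * rpoly (pCons a P) (\<zeta> ^ k)) =
       of_rat a * (\<Sum>k\<in>units. (\<zeta> ^ i) ^ k) + (\<Sum>k\<in>units. (\<zeta> ^ Suc i) ^ k * rpoly P (\<zeta> ^ k))"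
      by (simp add: algebra_simps sum.distrib sum_distrib_left)
    then show ?case
      using pCons.IH[of "Suc i"] trace_power_rational[of i] by (metis Rats_add Rats_mult Rats_of_rat)
  qed simp
  have "of_nat (card units) * x = (\<Sum>k\<in>units. conj k x)"
    using assms(2) by (simp add: units_def)
  also have "\<dots> = (\<Sum>k\<in>units. (\<zeta> ^ 0) ^ k * rpoly P (\<zeta> ^ k))"
    by (intro sum.cong) (auto simp: P conj_rpoly units_def)
  also have "\<dots> \<in> \<rat>" by (rule tr)
  finally have "of_nat (card units) * x / of_nat (card units) \<in> \<rat>"
    by (intro Rats_divide) auto
  moreover have "card units \<noteq> 0" using one_mod_unit by (auto simp: card_eq_0_iff)
  ultimately show ?thesis by simp
qed

text \<open>
The norm, that is, the product of all conjugates, is fixed by the conjugations and hence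
rational; the product of the conjugates other than \<open>x\<close> itself, divided by the norm, is the inverse.
\<close>

lemma L_inverse:
  assumes "x \<in> L" "x \<noteq> 0"
  shows "inverse x \<in> L"
proof -
  define N where "N = (\<Prod>k\<in>units. conj k x)"
  define M where "M = (\<Prod>k\<in>units - {1 mod n}. conj k x)"
  have cop: "coprime k n" if "k \<in> units" for k using that by (simp add: units_def)
  have M: "M \<in> L" unfolding M_def using assms by (intro L_prod) (auto intro: conj_L cop)
  have "N = conj (1 mod n) x * M"
    unfolding N_def M_def using one_mod_unit by (simp add: prod.remove)
  also have "conj (1 mod n) x = x"
    using conj_cong[of "1 mod n" 1 x] conj_one[OF assms(1)] by (simp only: cong_def mod_mod_trivial)
  finally have N: "N = x * M" .
  have "N \<noteq> 0" unfolding N_def using assms conj_eq_0 cop by (auto simp: prod_zero_iff)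
  have "N \<in> \<rat>"
  proof (rule fixed_rational)
    show "N \<in> L" unfolding N_def using assms by (intro L_prod) (auto intro: conj_L cop)
    fix l assume l: "coprime l n"
    have "conj l N = (\<Prod>k\<in>units. conj l (conj k x))"
      unfolding N_def by (rule conj_prod[OF l]) (use assms in \<open>auto intro: conj_L cop\<close>)
    also have "\<dots> = (\<Prod>k\<in>units. conj (k * l mod n) x)"
    proof (rule prod.cong[OF refl])
      fix k assume "k \<in> units"
      then have "conj l (conj k x) = conj (l * k) x"
        by (intro conj_conj l cop assms)
      then show "conj l (conj k x) = conj (k * l mod n) x"
        using conj_cong[of "k * l mod n" "k * l"] by (simp add: cong_def mult.commute)
    qed
    also have "\<dots> = N"
      unfolding N_def by (rule prod.reindex_bij_betw[OF units_mult_bij[OF l]])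
    finally show "conj l N = N" .
  qed
  then have "inverse N * M \<in> L" using M by (intro L_mult[OF L_rat]) auto
  moreover have "inverse x = inverse N * M"
    using \<open>N \<noteq> 0\<close> by (auto simp: N field_simps)
  ultimately show ?thesis by simp
qed

end

section \<open>Cyclotomic fields and quadratic fields inside the complex numbers\<close>

lemma complex_ring_simps [simp]:
  "carrier complex_ring = UNIV" "x \<oplus>\<^bsub>complex_ring\<^esub> y = x + y" "x \<otimes>\<^bsub>complex_ring\<^esub> y = x * y"
  "\<zero>\<^bsub>complex_ring\<^esub> = 0" "\<one>\<^bsub>complex_ring\<^esub> = 1"
  by (simp_all add: ring_of_type_algebra_def)

lemma field_complex_ring: "field complex_ring"
  by (rule field_from_type_algebra)

interpretation complex_ring: cring complex_ring
  by (rule cring_from_type_algebra)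

lemma complex_ring_minus [simp]: "\<ominus>\<^bsub>complex_ring\<^esub> x = - x"
  by (rule complex_ring.minus_equality) auto

lemma complex_ring_inv [simp]: "x \<noteq> 0 \<Longrightarrow> inv\<^bsub>complex_ring\<^esub> x = inverse x"
  by (rule complex_ring.comm_inv_char) auto

lemma (in primitive_root_of_unity) generate_field_eq_L:
  "generate_field complex_ring (\<rat> \<union> {\<zeta>}) = L"
proof
  have "x \<in> L" if "x \<in> generate_field complex_ring (\<rat> \<union> {\<zeta>})" for x
    using that
  proof (induction rule: generate_field.induct)
    case (incl h)
    then show ?case using L_rat L_power[of 1] by auto
  qed (auto intro: L_rat L_minus L_inverse L_add L_mult)
  then show "generate_field complex_ring (\<rat> \<union> {\<zeta>}) \<subseteq> L" by blast
  have "rpoly P \<zeta> \<in> generate_field complex_ring (\<rat> \<union> {\<zeta>})" for P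
  proof (induction P)
    case 0
    show ?case using field.zero_in_generate[OF field_complex_ring] by simp
  next
    case (pCons a P)
    have "of_rat a \<in> generate_field complex_ring (\<rat> \<union> {\<zeta>})" "\<zeta> \<in> generate_field complex_ring (\<rat> \<union> {\<zeta>})"
      by (auto intro: generate_field.incl)
    then show ?case
      using pCons.IH generate_field.eng_add generate_field.eng_mult
      by (metis complex_ring_simps(2,3) rpoly_pCons)
  qed
  then show "L \<subseteq> generate_field complex_ring (\<rat> \<union> {\<zeta>})" by (auto simp: L_def)
qed

lemma primitive_root_cis:
  assumes "n > 0"
  shows "primitive_root_of_unity n (cis (2 * pi / real n))"
proof
  fix j
  have "cis (2 * pi / real n) ^ j = cis (2 * pi * real j / real n)"
    by (simp add: DeMoivre algebra_simps)
  also have "\<dots> = 1 \<longleftrightarrow> n dvd j"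
  proof
    assume "cis (2 * pi * real j / real n) = 1"
    then have "cos (2 * pi * real j / real n) = 1"
      by (metis one_complex.sel(1) cis.sel(1))
    then obtain i where "2 * pi * real j / real n = of_int i * 2 * pi"
      by (auto simp: cos_one_2pi_int)
    then have "real j = of_int i * real n" using assms by (simp add: field_simps)
    then have "int j = i * int n" by (metis of_int_eq_iff of_int_mult of_int_of_nat_eq)
    then show "n dvd j" by (metis dvd_triv_right int_dvd_int_iff)
  next
    assume "n dvd j"
    then obtain i where "j = n * i" ..
    then have "2 * pi * real j / real n = 2 * pi * real i" using assms by simp
    then show "cis (2 * pi * real j / real n) = 1"
      using cis_multiple_2pi[of "real i"] by simp
  qed
  finally show "cis (2 * pi / real n) ^ j = 1 \<longleftrightarrow> n dvd j" .
qed (rule assms)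

definition rat_span2 :: "complex \<Rightarrow> complex \<Rightarrow> complex set" where
  "rat_span2 v w = {a * v + b * w | a b. a \<in> \<rat> \<and> b \<in> \<rat>}"

lemma rat_span2_commute: "rat_span2 v w = rat_span2 w v"
  unfolding rat_span2_def by (metis (no_types, opaque_lifting) add.commute)

lemma complex_line_extension: "complex_ring.line_extension K v E = {k * v + e | k e. k \<in> K \<and> e \<in> E}"
  by (auto simp: complex_ring.line_extension_def set_add_def set_mult_def r_coset_def)

lemma dimension_2_rat_iff:
  "complex_ring.dimension 2 \<rat> K \<longleftrightarrow> (\<exists>v w. w \<noteq> 0 \<and> v \<notin> {b * w | b. b \<in> \<rat>} \<and> K = rat_span2 v w)"
proof
  assume "complex_ring.dimension 2 \<rat> K"
  then obtain v E where v: "v \<notin> E" "complex_ring.dimension (Suc 0) \<rat> E"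
    and K: "K = complex_ring.line_extension \<rat> v E"
    unfolding numeral_2_eq_2 by (auto elim: complex_ring.dimension.cases)
  from v(2) obtain w F where w: "w \<notin> F" "complex_ring.dimension 0 \<rat> F"
    and E: "E = complex_ring.line_extension \<rat> w F"
    by (auto elim: complex_ring.dimension.cases)
  from w(2) have F: "F = {0}" by (auto elim: complex_ring.dimension.cases)
  show "\<exists>v w. w \<noteq> 0 \<and> v \<notin> {b * w | b. b \<in> \<rat>} \<and> K = rat_span2 v w"
  proof (intro exI conjI)
    show "w \<noteq> 0" using w F by simp
    show "v \<notin> {b * w | b. b \<in> \<rat>}" using v E F by (simp add: complex_line_extension)
    show "K = rat_span2 v w"
      unfolding K E F rat_span2_def complex_line_extension by auto
  qed
next
  assume "\<exists>v w. w \<noteq> 0 \<and> v \<notin> {b * w | b. b \<in> \<rat>} \<and> K = rat_span2 v w"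
  then obtain v w where w: "w \<noteq> 0" and v: "v \<notin> {b * w | b. b \<in> \<rat>}" and K: "K = rat_span2 v w"
    by blast
  have "complex_ring.dimension (Suc 0) \<rat> (complex_ring.line_extension \<rat> w {\<zero>\<^bsub>complex_ring\<^esub>})"
    using w by (intro complex_ring.Suc_dim complex_ring.zero_dim) auto
  then have "complex_ring.dimension (Suc 0) \<rat> {b * w | b. b \<in> \<rat>}"
    by (simp add: complex_line_extension)
  then have "complex_ring.dimension (Suc (Suc 0)) \<rat> (complex_ring.line_extension \<rat> v {b * w | b. b \<in> \<rat>})"
    using v by (intro complex_ring.Suc_dim) auto
  moreover have "complex_ring.line_extension \<rat> v {b * w | b. b \<in> \<rat>} = K"
    unfolding K rat_span2_def complex_line_extension by auto
  ultimately show "complex_ring.dimension 2 \<rat> K" by (simp add: numeral_2_eq_2)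
qed

text \<open>
Exchange step: in a two-dimensional space that contains \<open>1\<close>, either basis vector can be exchanged
for \<open>1\<close> provided that the other one is irrational.
\<close>

lemma rat_span2_one:
  assumes "1 \<in> rat_span2 v w" "w \<notin> \<rat>"
  shows "rat_span2 v w = rat_span2 1 w"
proof -
  obtain p q where pq: "p \<in> \<rat>" "q \<in> \<rat>" "1 = p * v + q * w"
    using assms(1) by (auto simp: rat_span2_def)
  have "p \<noteq> 0"
  proof
    assume "p = 0"
    then have "w = inverse q" using pq(3) by (auto simp: inverse_unique mult.commute)
    then show False using assms(2) pq(2) by simp
  qed
  then have v: "v = (1 - q * w) / p" using pq(3) by (simp add: field_simps)
  show ?thesis
  proof (intro equalityI subsetI)
    fix x assume "x \<in> rat_span2 v w"
    then obtain a b where ab: "a \<in> \<rat>" "b \<in> \<rat>" "x = a * v + b * w" by (auto simp: rat_span2_def)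
    then have "x = (a / p) * 1 + (b - a * q / p) * w"
      using \<open>p \<noteq> 0\<close> by (simp add: v field_simps)
    moreover have "a / p \<in> \<rat>" "b - a * q / p \<in> \<rat>" using ab pq by auto
    ultimately show "x \<in> rat_span2 1 w" unfolding rat_span2_def by blast
  next
    fix x assume "x \<in> rat_span2 1 w"
    then obtain a b where ab: "a \<in> \<rat>" "b \<in> \<rat>" "x = a * 1 + b * w" by (auto simp: rat_span2_def)
    have "(a * p) * v + (a * q + b) * w = a * (p * v + q * w) + b * w" by (simp add: algebra_simps)
    then have "x = (a * p) * v + (a * q + b) * w" by (simp add: ab(3) flip: pq(3))
    moreover have "a * p \<in> \<rat>" "a * q + b \<in> \<rat>" using ab pq by auto
    ultimately show "x \<in> rat_span2 v w" unfolding rat_span2_def by blast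
  qed
qed

lemma rat_span2_1E:
  assumes "x \<in> rat_span2 1 w"
  obtains a b where "a \<in> \<rat>" "b \<in> \<rat>" "x = a + b * w"
  using assms by (auto simp: rat_span2_def)

lemma rat_span2_1I: "a \<in> \<rat> \<Longrightarrow> b \<in> \<rat> \<Longrightarrow> a + b * w \<in> rat_span2 1 w"
  unfolding rat_span2_def by auto

lemma quadratic_field_generator:
  assumes "subfield K complex_ring" "complex_ring.dimension 2 \<rat> K"
  obtains \<alpha> where "\<alpha> \<in> K" "\<alpha> \<notin> \<rat>" "\<alpha>\<^sup>2 \<in> \<rat>" "K = rat_span2 1 \<alpha>"
proof -
  have one: "1 \<in> K" and mult: "\<And>x y. x \<in> K \<Longrightarrow> y \<in> K \<Longrightarrow> x * y \<in> K"
    using subringE(3,6)[OF subfieldE(1)[OF assms(1)]] by auto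
  obtain v w where w: "w \<noteq> 0" and v: "v \<notin> {b * w | b. b \<in> \<rat>}" and K: "K = rat_span2 v w"
    using assms(2) dimension_2_rat_iff by auto
  have "v \<notin> \<rat> \<or> w \<notin> \<rat>"
  proof (rule ccontr)
    assume "\<not> (v \<notin> \<rat> \<or> w \<notin> \<rat>)"
    then have "v / w \<in> \<rat>" "v = v / w * w" using w by auto
    then show False using v by blast
  qed
  then obtain \<gamma> where \<gamma>: "\<gamma> \<notin> \<rat>" "K = rat_span2 1 \<gamma>"
    using rat_span2_one[of v w] rat_span2_one[of w v] one unfolding K by (metis rat_span2_commute)
  have \<gamma>K: "\<gamma> \<in> K" using rat_span2_1I[of 0 1 \<gamma>] \<gamma>(2) by simp
  obtain s t where st: "s \<in> \<rat>" "t \<in> \<rat>" "\<gamma> * \<gamma> = s + t * \<gamma>"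
    using mult[OF \<gamma>K \<gamma>K] \<gamma>(2) by (auto elim: rat_span2_1E)
  \<comment> \<open>Completing the square removes the linear term of the quadratic equation.\<close>
  define \<alpha> where "\<alpha> = \<gamma> - t / 2"
  have "t / 2 \<in> \<rat>" using st by auto
  show ?thesis
  proof (rule that)
    show "\<alpha> \<notin> \<rat>"
      using \<gamma>(1) \<open>t / 2 \<in> \<rat>\<close> unfolding \<alpha>_def by (metis Rats_add diff_add_cancel)
    have "\<alpha>\<^sup>2 = \<gamma> * \<gamma> - t * \<gamma> + t * t / 4"
      by (simp add: \<alpha>_def power2_eq_square field_simps)
    also have "\<dots> = s + t * t / 4" by (simp add: st(3))
    finally show "\<alpha>\<^sup>2 \<in> \<rat>" using st by auto
    show "K = rat_span2 1 \<alpha>"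
    proof (intro equalityI subsetI)
      fix x assume "x \<in> K"
      then obtain a b where ab: "a \<in> \<rat>" "b \<in> \<rat>" "x = a + b * \<gamma>" using \<gamma>(2) by (auto elim: rat_span2_1E)
      have "x = (a + b * (t / 2)) + b * \<alpha>" by (simp add: ab(3) \<alpha>_def algebra_simps)
      then show "x \<in> rat_span2 1 \<alpha>" using ab \<open>t / 2 \<in> \<rat>\<close> by (metis Rats_add Rats_mult rat_span2_1I)
    next
      fix x assume "x \<in> rat_span2 1 \<alpha>"
      then obtain a b where ab: "a \<in> \<rat>" "b \<in> \<rat>" "x = a + b * \<alpha>" by (auto elim: rat_span2_1E)
      have "x = (a - b * (t / 2)) + b * \<gamma>" by (simp add: ab(3) \<alpha>_def algebra_simps)
      then show "x \<in> K" unfolding \<gamma>(2) using ab \<open>t / 2 \<in> \<rat>\<close> by (metis Rats_diff Rats_mult rat_span2_1I)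
    qed
    then show "\<alpha> \<in> K" using rat_span2_1I[of 0 1 \<alpha>] by simp
  qed
qed

text \<open>
Inverses come from rationalising the denominator: \<open>(a + b \<alpha>) (a - b \<alpha>)\<close> is rational, and it is nonzero
since \<open>\<alpha>\<close> is irrational.
\<close>

lemma quadratic_field_of_generator:
  assumes "\<alpha> \<notin> \<rat>" "\<alpha>\<^sup>2 \<in> \<rat>"
  shows "subfield (rat_span2 1 \<alpha>) complex_ring" "complex_ring.dimension 2 \<rat> (rat_span2 1 \<alpha>)"
proof -
  show "subfield (rat_span2 1 \<alpha>) complex_ring"
  proof (rule field.subfieldI'[OF field_complex_ring])
    show "subring (rat_span2 1 \<alpha>) complex_ring"
    proof (rule complex_ring.subringI)
      show "\<one>\<^bsub>complex_ring\<^esub> \<in> rat_span2 1 \<alpha>" using rat_span2_1I[of 1 0 \<alpha>] by simp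
    next
      fix h assume "h \<in> rat_span2 1 \<alpha>"
      then obtain a b where "a \<in> \<rat>" "b \<in> \<rat>" "h = a + b * \<alpha>" by (rule rat_span2_1E)
      then show "\<ominus>\<^bsub>complex_ring\<^esub> h \<in> rat_span2 1 \<alpha>"
        using rat_span2_1I[of "- a" "- b" \<alpha>] by simp
    next
      fix h h' assume "h \<in> rat_span2 1 \<alpha>" "h' \<in> rat_span2 1 \<alpha>"
      then obtain a b a' b' where ab: "a \<in> \<rat>" "b \<in> \<rat>" "h = a + b * \<alpha>"
        "a' \<in> \<rat>" "b' \<in> \<rat>" "h' = a' + b' * \<alpha>" by (metis rat_span2_1E)
      have "h + h' = (a + a') + (b + b') * \<alpha>" by (simp add: ab algebra_simps)
      then show "h \<oplus>\<^bsub>complex_ring\<^esub> h' \<in> rat_span2 1 \<alpha>"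
        unfolding complex_ring_simps by (simp only:) (intro rat_span2_1I Rats_add ab)
      have "h * h' = (a * a' + b * b' * \<alpha>\<^sup>2) + (a * b' + b * a') * \<alpha>"
        by (simp add: ab algebra_simps power2_eq_square)
      then show "h \<otimes>\<^bsub>complex_ring\<^esub> h' \<in> rat_span2 1 \<alpha>"
        unfolding complex_ring_simps by (simp only:) (intro rat_span2_1I Rats_add Rats_mult ab assms(2))
    qed simp
  next
    fix k assume k: "k \<in> rat_span2 1 \<alpha> - {\<zero>\<^bsub>complex_ring\<^esub>}"
    then obtain a b where ab: "a \<in> \<rat>" "b \<in> \<rat>" "k = a + b * \<alpha>" by (auto elim: rat_span2_1E)
    have b0: "a' = 0 \<and> b = 0" if "a' \<in> \<rat>" "a' = b * \<alpha>" for a'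
      using that ab(2) assms(1) by (metis Rats_divide mult_eq_0_iff nonzero_mult_div_cancel_left)
    have k0: "a + b * \<alpha> \<noteq> 0" using k ab by simp
    moreover have "a - b * \<alpha> \<noteq> 0" using b0[of a] ab k0 by auto
    ultimately have D: "a\<^sup>2 - b\<^sup>2 * \<alpha>\<^sup>2 \<noteq> 0"
      by (metis mult_eq_0_iff power_mult_distrib square_diff_square_factored power2_eq_square)
    have "inverse k = a / (a\<^sup>2 - b\<^sup>2 * \<alpha>\<^sup>2) + (- b / (a\<^sup>2 - b\<^sup>2 * \<alpha>\<^sup>2)) * \<alpha>"
    proof (rule inverse_unique)
      have "k * (a - b * \<alpha>) = a\<^sup>2 - b\<^sup>2 * \<alpha>\<^sup>2"
        by (simp add: ab(3) algebra_simps power2_eq_square)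
      then have "k * ((a - b * \<alpha>) / (a\<^sup>2 - b\<^sup>2 * \<alpha>\<^sup>2)) = 1" using D by simp
      then show "k * (a / (a\<^sup>2 - b\<^sup>2 * \<alpha>\<^sup>2) + (- b / (a\<^sup>2 - b\<^sup>2 * \<alpha>\<^sup>2)) * \<alpha>) = 1"
        by (simp add: diff_divide_distrib)
    qed
    then show "inv\<^bsub>complex_ring\<^esub> k \<in> rat_span2 1 \<alpha>"
      using k ab assms(2) rat_span2_1I[of "a / (a\<^sup>2 - b\<^sup>2 * \<alpha>\<^sup>2)" "- b / (a\<^sup>2 - b\<^sup>2 * \<alpha>\<^sup>2)" \<alpha>] by simp
  qed
  have "rat_span2 1 \<alpha> = rat_span2 \<alpha> 1" by (rule rat_span2_commute)
  moreover have "\<alpha> \<notin> {b * 1 | b. b \<in> \<rat>}" using assms(1) by auto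
  ultimately show "complex_ring.dimension 2 \<rat> (rat_span2 1 \<alpha>)"
    unfolding dimension_2_rat_iff by (intro exI[of _ \<alpha>] exI[of _ 1]) simp
qed

section \<open>Quadratic characters and quadratic subfields\<close>

text \<open>
Characters of the unit group of \<open>\<int>/n\<close> with values \<open>\<plusminus>1\<close>, in the style of Dirichlet characters:
periodic functions on the natural numbers that vanish outside the units. This normalisation makes
equality of characters the same as equality of functions.
\<close>

definition quadratic_characters :: "nat \<Rightarrow> (nat \<Rightarrow> int) set" where
  "quadratic_characters n = {\<chi>.
     (\<forall>k. coprime k n \<longrightarrow> \<chi> k \<in> {1, -1}) \<and> (\<forall>k. \<not> coprime k n \<longrightarrow> \<chi> k = 0) \<and>
     (\<forall>k l. \<chi> (k * l) = \<chi> k * \<chi> l) \<and> (\<forall>k l. [k = l] (mod n) \<longrightarrow> \<chi> k = \<chi> l)}"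

definition principal_character :: "nat \<Rightarrow> nat \<Rightarrow> int" where
  "principal_character n k = (if coprime k n then 1 else 0)"

lemma quadratic_charactersD:
  assumes "\<chi> \<in> quadratic_characters n"
  shows "coprime k n \<Longrightarrow> \<chi> k = 1 \<or> \<chi> k = -1" "\<not> coprime k n \<Longrightarrow> \<chi> k = 0"
    "\<chi> (k * l) = \<chi> k * \<chi> l" "[k = l] (mod n) \<Longrightarrow> \<chi> k = \<chi> l"
  using assms unfolding quadratic_characters_def by blast+

lemma quadratic_character_square:
  assumes "\<chi> \<in> quadratic_characters n" "coprime k n"
  shows "\<chi> k * \<chi> k = 1"
  using quadratic_charactersD(1)[OF assms] by auto

lemma quadratic_character_one:
  assumes "\<chi> \<in> quadratic_characters n"
  shows "\<chi> 1 = 1"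
  using quadratic_charactersD(1)[OF assms, of 1] quadratic_charactersD(3)[OF assms, of 1 1] by auto

lemma nonprincipal_characterE:
  assumes "\<chi> \<in> quadratic_characters n - {principal_character n}"
  obtains k where "coprime k n" "\<chi> k = -1"
proof -
  have \<chi>: "\<chi> \<in> quadratic_characters n" "\<chi> \<noteq> principal_character n" using assms by auto
  then obtain k where k: "\<chi> k \<noteq> principal_character n k" by auto
  have "coprime k n"
    using k quadratic_charactersD(2)[OF \<chi>(1), of k] by (auto simp: principal_character_def)
  moreover from this have "\<chi> k = -1"
    using k quadratic_charactersD(1)[OF \<chi>(1), of k] by (simp add: principal_character_def)
  ultimately show ?thesis by (rule that)
qed

context primitive_root_of_unity
begin

text \<open>
For a quadratic character \<open>\<chi>\<close> this is a rational line: the multiples of the square root that generates the quadratic field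
of \<open>\<chi>\<close>, or the rational numbers if \<open>\<chi>\<close> is principal.
\<close>

definition eigenspace :: "(nat \<Rightarrow> int) \<Rightarrow> complex set" where
  "eigenspace \<chi> = {x \<in> L. \<forall>k. coprime k n \<longrightarrow> conj k x = of_int (\<chi> k) * x}"

definition char_field :: "(nat \<Rightarrow> int) \<Rightarrow> complex set" where
  "char_field \<chi> = {a + x | a x. a \<in> \<rat> \<and> x \<in> eigenspace \<chi>}"

lemma eigenspace_L: "x \<in> eigenspace \<chi> \<Longrightarrow> x \<in> L"
  by (simp add: eigenspace_def)

lemma eigenspaceD: "x \<in> eigenspace \<chi> \<Longrightarrow> coprime k n \<Longrightarrow> conj k x = of_int (\<chi> k) * x"
  by (simp add: eigenspace_def)

text \<open>
Applying \<open>\<zeta> \<mapsto> \<zeta> ^ l\<close> permutes the summation index by multiplication with \<open>l\<close>, which changes the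
coefficients by \<open>\<chi>(l)\<close>, its own inverse.
\<close>

lemma gauss_sum_eigenvector:
  assumes "\<chi> \<in> quadratic_characters n"
  shows "(\<Sum>k\<in>units. of_int (\<chi> k) * \<zeta> ^ (j * k)) \<in> eigenspace \<chi>"
proof -
  define \<tau> where "\<tau> = (\<Sum>k\<in>units. of_int (\<chi> k) * \<zeta> ^ (j * k))"
  have summand: "of_int c * \<zeta> ^ i \<in> L" for c i
    by (intro L_mult[OF L_rat] L_power) auto
  have "conj l \<tau> = of_int (\<chi> l) * \<tau>" if l: "coprime l n" for l
  proof -
    have "conj l \<tau> = (\<Sum>k\<in>units. conj l (of_int (\<chi> k) * \<zeta> ^ (j * k)))"
      unfolding \<tau>_def by (rule conj_sum[OF l summand])
    also have "\<dots> = (\<Sum>k\<in>units. of_int (\<chi> l) * (of_int (\<chi> (k * l mod n)) * \<zeta> ^ (j * (k * l mod n))))"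
    proof (rule sum.cong[OF refl])
      fix k
      have "\<chi> (k * l mod n) = \<chi> k * \<chi> l"
        using quadratic_charactersD(3,4)[OF assms] by (metis cong_mod_left cong_refl)
      then have c: "\<chi> l * \<chi> (k * l mod n) = \<chi> k"
        using quadratic_character_square[OF assms l] by (simp add: algebra_simps)
      have "[j * (k * l mod n) = j * k * l] (mod n)"
        by (simp add: cong_def mod_mult_right_eq mult.assoc)
      then have z: "\<zeta> ^ (j * (k * l mod n)) = \<zeta> ^ (j * k * l)" by (rule power_cong)
      have "conj l (of_int (\<chi> k) * \<zeta> ^ (j * k)) = of_int (\<chi> k) * \<zeta> ^ (j * k * l)"
        using l by (simp add: conj_mult conj_rat conj_power L_rat L_power)
      also have "\<dots> = of_int (\<chi> l * \<chi> (k * l mod n)) * \<zeta> ^ (j * (k * l mod n))"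
        unfolding c z ..
      finally show "conj l (of_int (\<chi> k) * \<zeta> ^ (j * k)) =
          of_int (\<chi> l) * (of_int (\<chi> (k * l mod n)) * \<zeta> ^ (j * (k * l mod n)))"
        by (simp add: mult.assoc)
    qed
    also have "\<dots> = of_int (\<chi> l) * (\<Sum>k\<in>units. of_int (\<chi> (k * l mod n)) * \<zeta> ^ (j * (k * l mod n)))"
      by (simp add: sum_distrib_left)
    also have "(\<Sum>k\<in>units. of_int (\<chi> (k * l mod n)) * \<zeta> ^ (j * (k * l mod n))) = \<tau>"
      unfolding \<tau>_def by (rule sum.reindex_bij_betw[OF units_mult_bij[OF l]])
    finally show ?thesis .
  qed
  moreover have "\<tau> \<in> L" unfolding \<tau>_def by (intro L_sum summand)
  ultimately show ?thesis by (simp add: eigenspace_def \<tau>_def)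
qed

text \<open>
A single Gauss sum can vanish when \<open>\<chi>\<close> is imprimitive and \<open>j\<close> is badly chosen. But the Gauss sums for all
\<open>j\<close> form the Fourier transform of \<open>\<chi>\<close>, from which the value \<open>\<chi>(1) = 1\<close> can be recovered; hence they do
not all vanish.
\<close>

lemma eigenspace_nonzero:
  assumes "\<chi> \<in> quadratic_characters n"
  obtains x where "x \<in> eigenspace \<chi>" "x \<noteq> 0"
proof -
  define \<tau> where "\<tau> j = (\<Sum>k\<in>units. of_int (\<chi> k) * \<zeta> ^ (j * k))" for j
  have geom: "(\<Sum>j<n. \<zeta> ^ (j * (n - 1 + k))) = (if k = 1 mod n then of_nat n else 0)" if "k \<in> units" for k
  proof -
    have "k < n" using that by (simp add: units_def)
    have "n dvd n - 1 + k \<longleftrightarrow> k = 1 mod n"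
    proof (cases "n = 1")
      case False
      then have "n > 1" using n_pos by simp
      show ?thesis
      proof
        assume "n dvd n - 1 + k"
        then obtain c where c: "n - 1 + k = n * c" ..
        have "n * c < n * 2" "n * c > 0" using c[symmetric] \<open>k < n\<close> \<open>n > 1\<close> by linarith+
        then have "c = 1" by auto
        then show "k = 1 mod n" using c \<open>n > 1\<close> by simp
      next
        assume "k = 1 mod n"
        then show "n dvd n - 1 + k" using \<open>n > 1\<close> by simp
      qed
    qed (use \<open>k < n\<close> in simp)
    then have one: "\<zeta> ^ (n - 1 + k) = 1 \<longleftrightarrow> k = 1 mod n" by (simp only: root_iff)
    have "(\<Sum>j<n. \<zeta> ^ (j * (n - 1 + k))) = (\<Sum>j<n. (\<zeta> ^ (n - 1 + k)) ^ j)"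
      by (intro sum.cong refl) (simp only: mult.commute flip: power_mult)
    also have "\<dots> = (if \<zeta> ^ (n - 1 + k) = 1 then of_nat n else 0)"
      by (rule sum_root_of_unity) (simp add: root_iff flip: power_mult)
    finally show ?thesis unfolding one .
  qed
  \<comment> \<open>Fourier inversion at \<open>1\<close>, with \<open>\<zeta> ^ (n - 1)\<close> in the role of the inverse of \<open>\<zeta>\<close>.\<close>
  have "(\<Sum>j<n. \<zeta> ^ (j * (n - 1)) * \<tau> j) =
      (\<Sum>j<n. \<Sum>k\<in>units. of_int (\<chi> k) * \<zeta> ^ (j * (n - 1 + k)))"
    unfolding \<tau>_def sum_distrib_left distrib_left power_add
    by (intro sum.cong refl) (simp only: mult.left_commute)
  also have "\<dots> = (\<Sum>k\<in>units. of_int (\<chi> k) * (\<Sum>j<n. \<zeta> ^ (j * (n - 1 + k))))"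
    by (subst sum.swap) (simp add: sum_distrib_left)
  also have "\<dots> = (\<Sum>k\<in>units. if k = 1 mod n then of_int (\<chi> k) * of_nat n else 0)"
    by (intro sum.cong refl, subst geom) auto
  also have "\<dots> = of_int (\<chi> (1 mod n)) * of_nat n"
    using one_mod_unit by simp
  also have "\<chi> (1 mod n) = \<chi> 1"
    by (rule quadratic_charactersD(4)[OF assms]) (simp add: cong_def)
  also have "\<chi> 1 = 1" by (rule quadratic_character_one[OF assms])
  finally have "(\<Sum>j<n. \<zeta> ^ (j * (n - 1)) * \<tau> j) \<noteq> 0" using n_pos by simp
  then obtain j where "\<tau> j \<noteq> 0" by (metis (no_types, lifting) mult_zero_right sum.neutral)
  then show ?thesis using that gauss_sum_eigenvector[OF assms] unfolding \<tau>_def by blast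
qed

lemma eigenspace_mult_rational:
  assumes "\<chi> \<in> quadratic_characters n" "x \<in> eigenspace \<chi>" "y \<in> eigenspace \<chi>"
  shows "x * y \<in> \<rat>"
proof (rule fixed_rational)
  show "x * y \<in> L" using assms by (auto intro: L_mult eigenspace_L)
  fix k assume k: "coprime k n"
  have "conj k (x * y) = of_int (\<chi> k * \<chi> k) * (x * y)"
    using assms k by (simp add: conj_mult eigenspace_L eigenspaceD)
  then show "conj k (x * y) = x * y"
    using quadratic_character_square[OF assms(1) k] by simp
qed

lemma eigenvector_irrational:
  assumes "\<chi> \<in> quadratic_characters n - {principal_character n}" "x \<in> eigenspace \<chi>" "x \<noteq> 0"
  shows "x \<notin> \<rat>"
proof
  assume "x \<in> \<rat>"
  obtain k where "coprime k n" "\<chi> k = -1" using assms(1) by (rule nonprincipal_characterE)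
  then show False
    using conj_rat[of k x] eigenspaceD[OF assms(2), of k] \<open>x \<in> \<rat>\<close> assms(3) by simp
qed

lemma char_field_eq_span:
  assumes "\<chi> \<in> quadratic_characters n" "x \<in> eigenspace \<chi>" "x \<noteq> 0"
  shows "char_field \<chi> = rat_span2 1 x"
proof (intro equalityI subsetI)
  fix z assume "z \<in> char_field \<chi>"
  then obtain a y where y: "a \<in> \<rat>" "y \<in> eigenspace \<chi>" "z = a + y" by (auto simp: char_field_def)
  have "y = (y * x) / (x * x) * x" using assms(3) by simp
  moreover have "(y * x) / (x * x) \<in> \<rat>"
    using eigenspace_mult_rational[OF assms(1)] y assms(2) by (intro Rats_divide) auto
  ultimately show "z \<in> rat_span2 1 x" using y by (metis rat_span2_1I)
next
  fix z assume "z \<in> rat_span2 1 x"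
  then obtain a b where ab: "a \<in> \<rat>" "b \<in> \<rat>" "z = a + b * x" by (rule rat_span2_1E)
  have "b * x \<in> eigenspace \<chi>"
    using ab(2) assms(2) by (auto simp: eigenspace_def conj_mult conj_rat L_rat intro: L_mult L_rat)
  then show "z \<in> char_field \<chi>" using ab by (auto simp: char_field_def)
qed

lemma char_field_quadratic:
  assumes "\<chi> \<in> quadratic_characters n - {principal_character n}"
  shows "char_field \<chi> \<in> quadratic_subfields L"
proof -
  have \<chi>: "\<chi> \<in> quadratic_characters n" using assms by simp
  obtain x where x: "x \<in> eigenspace \<chi>" "x \<noteq> 0" using eigenspace_nonzero[OF \<chi>] .
  have "x \<notin> \<rat>" "x\<^sup>2 \<in> \<rat>"
    using eigenvector_irrational[OF assms x] eigenspace_mult_rational[OF \<chi> x(1) x(1)]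
    by (auto simp: power2_eq_square)
  moreover have "char_field \<chi> \<subseteq> L" by (auto simp: char_field_def intro: L_add L_rat eigenspace_L)
  ultimately show ?thesis
    using quadratic_field_of_generator char_field_eq_span[OF \<chi> x] by (simp add: quadratic_subfields_def)
qed

text \<open>
If \<open>x = a + y\<close> with \<open>x\<close> and \<open>y\<close> in the eigenspaces of \<open>\<chi>\<close> and \<open>\<psi>\<close>, then a conjugation on which the two
characters have opposite signs would make \<open>x\<close> either rational or zero.
\<close>

lemma char_field_inj:
  assumes \<chi>: "\<chi> \<in> quadratic_characters n - {principal_character n}"
    and \<psi>: "\<psi> \<in> quadratic_characters n"
    and eq: "char_field \<chi> = char_field \<psi>"
  shows "\<chi> = \<psi>"
proof
  fix k
  have \<chi>': "\<chi> \<in> quadratic_characters n" using \<chi> by simp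
  show "\<chi> k = \<psi> k"
  proof (cases "coprime k n")
    case True
    obtain x where x: "x \<in> eigenspace \<chi>" "x \<noteq> 0" using eigenspace_nonzero[OF \<chi>'] .
    have "x \<in> char_field \<chi>"
      unfolding char_field_def using x(1) by (intro CollectI exI[of _ 0] exI[of _ x]) simp
    then obtain a y where y: "a \<in> \<rat>" "y \<in> eigenspace \<psi>" "x = a + y"
      unfolding eq by (auto simp: char_field_def)
    have "of_int (\<chi> k) * x = conj k x" using eigenspaceD[OF x(1) True] by simp
    also have "\<dots> = a + of_int (\<psi> k) * y"
      using y True by (simp add: conj_add L_rat eigenspace_L conj_rat eigenspaceD)
    finally have k: "of_int (\<chi> k) * x = a + of_int (\<psi> k) * y" .
    show ?thesis
    proof (rule ccontr)
      assume "\<chi> k \<noteq> \<psi> k"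
      then consider "\<chi> k = 1" "\<psi> k = -1" | "\<chi> k = -1" "\<psi> k = 1"
        using quadratic_charactersD(1)[OF \<chi>' True] quadratic_charactersD(1)[OF \<psi> True] by auto
      then show False
      proof cases
        case 1
        then have "y = 0" using k y(3) by simp
        then show False using y eigenvector_irrational[OF \<chi> x] by simp
      next
        case 2
        then have "- x = x" using k y(3) by simp
        then show False using x(2) by simp
      qed
    qed
  qed (simp add: quadratic_charactersD(2)[OF \<chi>'] quadratic_charactersD(2)[OF \<psi>])
qed

text \<open>
The character is read off from the action on a square root \<open>\<alpha>\<close> that generates \<open>K\<close>: a conjugate of
\<open>\<alpha>\<close> is again a square root of \<open>\<alpha>\<^sup>2\<close>, so it is \<open>\<alpha>\<close> or \<open>-\<alpha>\<close>. This character is not principal, because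
otherwise \<open>\<alpha>\<close> would be fixed by all conjugations and hence be rational.
\<close>

lemma char_field_surj:
  assumes "K \<in> quadratic_subfields L"
  obtains \<chi> where "\<chi> \<in> quadratic_characters n - {principal_character n}" "char_field \<chi> = K"
proof -
  have K: "subfield K complex_ring" "complex_ring.dimension 2 \<rat> K" and "K \<subseteq> L"
    using assms by (auto simp: quadratic_subfields_def)
  obtain \<alpha> where \<alpha>: "\<alpha> \<in> K" "\<alpha> \<notin> \<rat>" "\<alpha>\<^sup>2 \<in> \<rat>" and K\<alpha>: "K = rat_span2 1 \<alpha>"
    using quadratic_field_generator[OF K] .
  have \<alpha>L: "\<alpha> \<in> L" and \<alpha>0: "\<alpha> \<noteq> 0" using \<alpha> \<open>K \<subseteq> L\<close> by auto
  define \<chi> :: "nat \<Rightarrow> int" where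
    "\<chi> k = (if coprime k n then if conj k \<alpha> = \<alpha> then 1 else -1 else 0)" for k
  have conj\<alpha>: "conj k \<alpha> = of_int (\<chi> k) * \<alpha>" if "coprime k n" for k
  proof -
    have "(conj k \<alpha>)\<^sup>2 = conj k (\<alpha>\<^sup>2)"
      using that \<alpha>L by (simp add: power2_eq_square conj_mult)
    also have "\<dots> = \<alpha>\<^sup>2" by (rule conj_rat[OF that \<alpha>(3)])
    finally show ?thesis using that by (auto simp: \<chi>_def power2_eq_iff)
  qed
  have mult: "\<chi> (k * l) = \<chi> k * \<chi> l" for k l
  proof (cases "coprime k n \<and> coprime l n")
    case True
    have "of_int (\<chi> (k * l)) * \<alpha> = conj (k * l) \<alpha>"
      using True conj\<alpha>[of "k * l"] by simp
    also have "\<dots> = conj k (conj l \<alpha>)" using True \<alpha>L by (simp add: conj_conj)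
    also have "\<dots> = of_int (\<chi> l) * (of_int (\<chi> k) * \<alpha>)"
      using True \<alpha>L by (simp add: conj\<alpha> conj_mult L_rat conj_rat)
    finally have "(of_int (\<chi> (k * l)) :: complex) = of_int (\<chi> k * \<chi> l)" using \<alpha>0 by simp
    then show ?thesis by (simp only: of_int_eq_iff)
  qed (auto simp: \<chi>_def)
  have \<chi>: "\<chi> \<in> quadratic_characters n"
    unfolding quadratic_characters_def
  proof (intro CollectI conjI allI impI)
    fix k l assume "[k = l] (mod n)"
    then show "\<chi> k = \<chi> l"
      unfolding \<chi>_def using conj_cong[of k l \<alpha>] coprime_cong_cong_left[of k l n] by simp
  qed (use mult in \<open>simp_all add: \<chi>_def\<close>)
  have "\<chi> \<noteq> principal_character n"
  proof
    assume "\<chi> = principal_character n"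
    then have "conj k \<alpha> = \<alpha>" if "coprime k n" for k
      using conj\<alpha>[OF that] that by (simp add: principal_character_def)
    then show False using fixed_rational[OF \<alpha>L] \<alpha>(2) by blast
  qed
  moreover have "\<alpha> \<in> eigenspace \<chi>" using \<alpha>L conj\<alpha> by (simp add: eigenspace_def)
  ultimately show ?thesis
    using that[of \<chi>] \<chi> K\<alpha> char_field_eq_span[OF \<chi> _ \<alpha>0] by simp
qed

lemma bij_betw_characters_quadratic_subfields:
  "bij_betw char_field (quadratic_characters n - {principal_character n}) (quadratic_subfields L)"
proof (rule bij_betw_imageI)
  show "inj_on char_field (quadratic_characters n - {principal_character n})"
    using char_field_inj by (auto simp: inj_on_def)
  show "char_field ` (quadratic_characters n - {principal_character n}) = quadratic_subfields L"
    using char_field_quadratic by (auto elim: char_field_surj)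
qed

end

section \<open>Idempotents and ring homomorphisms between residue rings\<close>

lemma primes_pairwise_coprime:
  fixes p q :: nat
  assumes "p \<in> prime_factors n" "q \<in> prime_factors n" "p \<noteq> q"
  shows "coprime p q"
  using assms by (intro primes_coprime) (auto simp: in_prime_factors_iff)

lemma squarefree_prod_prime_factors:
  fixes n :: nat
  assumes "squarefree n"
  shows "(\<Prod>p\<in>prime_factors n. p) = n"
proof -
  have "n \<noteq> 0" using assms by (metis not_squarefree_0)
  have "(\<Prod>p\<in>prime_factors n. p) = (\<Prod>p\<in>prime_factors n. p ^ multiplicity p n)"
    using assms \<open>n \<noteq> 0\<close> by (intro prod.cong refl) (auto simp: squarefree_factorial_semiring')
  then show ?thesis using \<open>n \<noteq> 0\<close> by (simp add: prod_prime_factors)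
qed

lemma squarefree_cong_iff:
  fixes n :: nat
  assumes "squarefree n"
  shows "[a = b] (mod n) \<longleftrightarrow> (\<forall>p\<in>prime_factors n. [a = b] (mod p))"
proof
  assume "[a = b] (mod n)"
  then show "\<forall>p\<in>prime_factors n. [a = b] (mod p)"
    by (auto intro: cong_dvd_modulus_nat simp: in_prime_factors_iff)
next
  assume "\<forall>p\<in>prime_factors n. [a = b] (mod p)"
  then have "[a = b] (mod (\<Prod>p\<in>prime_factors n. p))"
    by (intro coprime_cong_prod_nat primes_pairwise_coprime) auto
  then show "[a = b] (mod n)" by (simp add: squarefree_prod_prime_factors[OF assms])
qed

lemma crt_prime_factors:
  fixes n :: nat
  shows "\<exists>x. \<forall>p\<in>prime_factors n. [x = u p] (mod p)"
  by (rule chinese_remainder_nat) (auto intro: primes_pairwise_coprime)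

text \<open>
An idempotent is \<open>0\<close> or \<open>1\<close> modulo each prime divisor of \<open>n\<close>; it is encoded by the set of primes
at which it is \<open>0\<close>.
\<close>

lemma card_idempotents:
  fixes n :: nat
  assumes "squarefree n"
  shows "card {e. e < n \<and> [e * e = e] (mod n)} = 2 ^ card (prime_factors n)"
proof -
  let ?P = "prime_factors n" and ?I = "{e. e < n \<and> [e * e = e] (mod n)}"
  have n: "n > 0" using assms by (metis not_squarefree_0 gr0I)
  have "bij_betw (\<lambda>e. {p \<in> ?P. p dvd e}) ?I (Pow ?P)"
  proof (rule bij_betw_imageI)
    show "inj_on (\<lambda>e. {p \<in> ?P. p dvd e}) ?I"
    proof (rule inj_onI)
      fix a b assume a: "a \<in> ?I" and b: "b \<in> ?I" and eq: "{p \<in> ?P. p dvd a} = {p \<in> ?P. p dvd b}"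
      have one: "[e = 1] (mod p)" if "e \<in> ?I" "p \<in> ?P" "\<not> p dvd e" for e p
      proof -
        have "prime p" using that(2) by (simp add: in_prime_factors_iff)
        then have "coprime e p" using that(3) using prime_imp_coprime coprime_commute by blast
        moreover have "[e * e = e * 1] (mod p)"
          using that(1,2) squarefree_cong_iff[OF assms] by auto
        ultimately show ?thesis by (simp only: cong_mult_lcancel_nat)
      qed
      have "[a = b] (mod p)" if "p \<in> ?P" for p
      proof (cases "p dvd a")
        case True
        then have "p dvd b" using eq that by blast
        then show ?thesis using True by (metis cong_0_iff cong_sym cong_trans)
      next
        case False
        then have "\<not> p dvd b" using eq that by blast
        then show ?thesis using one[OF a that False] one[OF b that] by (metis cong_sym cong_trans)
      qed
      then have "[a = b] (mod n)" using squarefree_cong_iff[OF assms] by blast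
      then show "a = b" using a b by (simp add: cong_def)
    qed
    show "(\<lambda>e. {p \<in> ?P. p dvd e}) ` ?I = Pow ?P"
    proof (intro equalityI subsetI)
      fix D assume "D \<in> Pow ?P"
      obtain x where x: "\<And>p. p \<in> ?P \<Longrightarrow> [x = (if p \<in> D then 0 else 1)] (mod p)"
        using crt_prime_factors[of n "\<lambda>p. if p \<in> D then 0 else 1"] by blast
      define e where "e = x mod n"
      have e: "[e = (if p \<in> D then 0 else 1)] (mod p)" if "p \<in> ?P" for p
      proof -
        have "[e = x] (mod n)" by (simp add: e_def cong_def)
        then show ?thesis using x[OF that] that squarefree_cong_iff[OF assms] by (metis cong_trans)
      qed
      have "[e * e = e] (mod p)" if "p \<in> ?P" for p
      proof -
        have "[e * e = (if p \<in> D then 0 else 1) * (if p \<in> D then 0 else 1)] (mod p)"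
          using e[OF that] by (intro cong_mult)
        also have "(if p \<in> D then 0 else 1) * (if p \<in> D then 0 else 1) = (if p \<in> D then 0 else 1 :: nat)"
          by simp
        finally show ?thesis by (rule cong_trans[OF _ cong_sym[OF e[OF that]]])
      qed
      then have "e \<in> ?I" using n squarefree_cong_iff[OF assms] by (simp add: e_def)
      moreover have "{p \<in> ?P. p dvd e} = D"
      proof -
        have "p dvd e \<longleftrightarrow> p \<in> D" if "p \<in> ?P" for p
        proof -
          have "p > 1" using that prime_gt_1_nat[of p] by (simp add: in_prime_factors_iff)
          then show ?thesis using e[OF that] by (auto simp: cong_def mod_eq_0_iff_dvd split: if_splits)
        qed
        then show ?thesis using \<open>D \<in> Pow ?P\<close> by auto
      qed
      ultimately show "D \<in> (\<lambda>e. {p \<in> ?P. p dvd e}) ` ?I" by blast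
    qed auto
  qed
  then have "card ?I = card (Pow ?P)" by (rule bij_betw_same_card)
  then show ?thesis by (simp add: card_Pow)
qed

lemma carrier_ZFact: "carrier (ZFact k) = range (ZMod k)"
  by (auto simp: ZFact_def FactRing_def A_RCOSETS_defs ZMod_def a_r_coset_def)

lemma ideal_int: "ideal (Idl\<^bsub>\<Z>\<^esub> {k}) \<Z>"
  by (rule int.genideal_ideal) simp

lemma ZMod_add: "ZMod k a \<oplus>\<^bsub>ZFact k\<^esub> ZMod k b = ZMod k (a + b)"
  using abelian_subgroup.a_rcos_sum[OF ideal.axioms(1)[THEN additive_subgroup.is_additive_subgroup, THEN abelian_subgroupI3[OF _ int.is_abelian_group]], OF ideal_int]
  by (simp add: ZFact_def FactRing_def ZMod_def)

lemma ZMod_mult: "ZMod k a \<otimes>\<^bsub>ZFact k\<^esub> ZMod k b = ZMod k (a * b)"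
  using ideal.rcoset_mult_add[OF ideal_int, of a b k]
  by (simp add: ZFact_def FactRing_def ZMod_def)

lemma ZMod_eq_iff: "ZMod k a = ZMod k b \<longleftrightarrow> [a = b] (mod k)"
  by (simp add: ZMod_eq_mod cong_def)

text \<open>
Multiplication by \<open>e\<close>. The carrier of the factor ring consists of cosets, so an integer representing the argument
has to be chosen; \<open>idempotent_hom_ZMod\<close> shows that the choice is immaterial.
\<close>

definition idempotent_hom :: "nat \<Rightarrow> nat \<Rightarrow> nat \<Rightarrow> int set \<Rightarrow> int set" where
  "idempotent_hom m n e =
     restrict (\<lambda>A. ZMod (int n) (int e * (SOME x. A = ZMod (int m) x))) (carrier (ZFact (int m)))"

lemma idempotent_hom_ZMod:
  assumes "n dvd m"
  shows "idempotent_hom m n e (ZMod (int m) x) = ZMod (int n) (int e * x)"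
proof -
  define y where "y = (SOME y. ZMod (int m) x = ZMod (int m) y)"
  have "ZMod (int m) x = ZMod (int m) y"
    unfolding y_def by (rule someI[of _ x]) simp
  then have "[x = y] (mod int n)"
    using assms by (auto simp: ZMod_eq_iff intro: cong_dvd_modulus)
  then have "[int e * y = int e * x] (mod int n)"
    by (intro cong_mult cong_refl) (rule cong_sym)
  then have "ZMod (int n) (int e * y) = ZMod (int n) (int e * x)"
    by (simp only: ZMod_eq_iff)
  moreover have "ZMod (int m) x \<in> carrier (ZFact (int m))" by (auto simp: carrier_ZFact)
  ultimately show ?thesis by (simp add: idempotent_hom_def y_def)
qed

text \<open>
Every class modulo \<open>m\<close> is a multiple of the class of \<open>1\<close> by a natural number, so additivity determines a
homomorphism from the image of \<open>1\<close>, and multiplicativity at \<open>1 = 1 * 1\<close> makes that image idempotent.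
\<close>

lemma bij_betw_idempotents_rng_hom:
  assumes "n > 0" "m > 0" "n dvd m"
  shows "bij_betw (idempotent_hom m n) {e. e < n \<and> [e * e = e] (mod n)}
           (rng_hom (ZFact (int m)) (ZFact (int n)))"
proof (rule bij_betw_imageI)
  let ?I = "{e. e < n \<and> [e * e = e] (mod n)}"
  note hom = idempotent_hom_ZMod[OF assms(3)]
  show "inj_on (idempotent_hom m n) ?I"
  proof (rule inj_onI)
    fix a b assume ab: "a \<in> ?I" "b \<in> ?I" "idempotent_hom m n a = idempotent_hom m n b"
    then have "[int a = int b] (mod int n)"
      using hom[of a 1] hom[of b 1] by (simp flip: ZMod_eq_iff)
    then show "a = b" using ab by (simp add: cong_int_iff) (simp add: cong_def)
  qed
  show "idempotent_hom m n ` ?I = rng_hom (ZFact (int m)) (ZFact (int n))"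
  proof (intro equalityI subsetI)
    fix f assume "f \<in> idempotent_hom m n ` ?I"
    then obtain e where e: "[e * e = e] (mod n)" and f: "f = idempotent_hom m n e" by auto
    have ee: "[int e * int e = int e] (mod int n)"
      using e by (metis cong_int_iff of_nat_mult)
    show "f \<in> rng_hom (ZFact (int m)) (ZFact (int n))"
      unfolding rng_hom_def
    proof (intro CollectI conjI ballI)
      show "f \<in> carrier (ZFact (int m)) \<rightarrow>\<^sub>E carrier (ZFact (int n))"
      proof (rule PiE_I)
        fix A assume "A \<in> carrier (ZFact (int m))"
        then show "f A \<in> carrier (ZFact (int n))" by (auto simp: f hom carrier_ZFact)
      next
        fix A assume "A \<notin> carrier (ZFact (int m))"
        then show "f A = undefined" by (simp add: f idempotent_hom_def)
      qed
    next
      fix A B assume "A \<in> carrier (ZFact (int m))" "B \<in> carrier (ZFact (int m))"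
      then obtain x y where AB: "A = ZMod (int m) x" "B = ZMod (int m) y" by (auto simp: carrier_ZFact)
      show "f (A \<oplus>\<^bsub>ZFact (int m)\<^esub> B) = f A \<oplus>\<^bsub>ZFact (int n)\<^esub> f B"
        by (simp add: AB ZMod_add f hom distrib_left)
      have "[int e * (x * y) = int e * int e * (x * y)] (mod int n)"
        using ee by (intro cong_mult cong_refl) (rule cong_sym)
      then show "f (A \<otimes>\<^bsub>ZFact (int m)\<^esub> B) = f A \<otimes>\<^bsub>ZFact (int n)\<^esub> f B"
        by (simp add: AB ZMod_mult f hom ZMod_eq_iff mult_ac)
    qed
  next
    fix f assume f: "f \<in> rng_hom (ZFact (int m)) (ZFact (int n))"
    have add: "f (ZMod (int m) (x + y)) = f (ZMod (int m) x) \<oplus>\<^bsub>ZFact (int n)\<^esub> f (ZMod (int m) y)"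
      and mult: "f (ZMod (int m) (x * y)) = f (ZMod (int m) x) \<otimes>\<^bsub>ZFact (int n)\<^esub> f (ZMod (int m) y)" for x y
      using f unfolding rng_hom_def by (auto simp: carrier_ZFact simp flip: ZMod_add ZMod_mult)
    have ext: "f \<in> extensional (carrier (ZFact (int m)))"
      and val: "\<exists>c. f (ZMod (int m) x) = ZMod (int n) c" for x
    proof -
      have PiE: "f \<in> carrier (ZFact (int m)) \<rightarrow>\<^sub>E carrier (ZFact (int n))"
        using f by (simp add: rng_hom_def)
      then show "f \<in> extensional (carrier (ZFact (int m)))" by (simp add: PiE_def)
      have "f (ZMod (int m) x) \<in> carrier (ZFact (int n))"
        using PiE by (rule PiE_mem) (simp add: carrier_ZFact)
      then show "\<exists>c. f (ZMod (int m) x) = ZMod (int n) c" by (auto simp: carrier_ZFact)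
    qed
    obtain c where c: "f (ZMod (int m) 1) = ZMod (int n) c" using val by blast
    define e where "e = nat (c mod int n)"
    have "[int e = c] (mod int n)" using assms(1) by (simp add: e_def cong_def)
    then have fe: "f (ZMod (int m) 1) = ZMod (int n) (int e)" by (simp add: c ZMod_eq_iff cong_sym)
    have "[int e * int e = int e] (mod int n)"
      using mult[of 1 1] by (simp add: fe ZMod_mult ZMod_eq_iff cong_sym)
    then have "[e * e = e] (mod n)" by (metis cong_int_iff of_nat_mult)
    moreover have "e < n"
      using assms(1) by (simp add: e_def nat_less_iff)
    moreover have "f = idempotent_hom m n e"
    proof (rule extensionalityI[OF ext])
      show "idempotent_hom m n e \<in> extensional (carrier (ZFact (int m)))"
        by (simp add: idempotent_hom_def)
      have nat: "f (ZMod (int m) (int x)) = ZMod (int n) (int e * int x)" for x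
      proof (induction x)
        case 0
        obtain d where d: "f (ZMod (int m) 0) = ZMod (int n) d" using val by blast
        have "[d = d + d] (mod int n)" using add[of 0 0] by (simp add: d ZMod_add ZMod_eq_iff)
        then have "[d = 0] (mod int n)" by (simp add: cong_iff_dvd_diff)
        then show ?case by (simp add: d ZMod_eq_iff)
      next
        case (Suc x)
        have "f (ZMod (int m) (int (Suc x))) = f (ZMod (int m) (int x + 1))" by (simp add: add.commute)
        also have "\<dots> = ZMod (int n) (int e * int x + int e)"
          by (simp only: add Suc.IH fe ZMod_add)
        finally show ?case by (simp add: algebra_simps)
      qed
      fix A assume "A \<in> carrier (ZFact (int m))"
      then obtain x where "A = ZMod (int m) x" by (auto simp: carrier_ZFact)
      also have "ZMod (int m) x = ZMod (int m) (int (nat (x mod int m)))"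
        using assms(2) by (simp add: ZMod_eq_iff cong_def)
      finally show "f A = idempotent_hom m n e A" by (simp only: nat hom)
    qed
    ultimately show "f \<in> idempotent_hom m n ` ?I" by blast
  qed
qed

section \<open>Quadratic characters of an odd squarefree modulus\<close>

lemma Legendre_cong: "[a = b] (mod p) \<Longrightarrow> Legendre a p = Legendre b p"
proof -
  assume ab: "[a = b] (mod p)"
  have "[x = a] (mod p) \<longleftrightarrow> [x = b] (mod p)" for x
    using ab cong_sym cong_trans by blast
  moreover have "[a = 0] (mod p) \<longleftrightarrow> [b = 0] (mod p)"
    using ab cong_sym cong_trans by blast
  ultimately show ?thesis by (simp add: Legendre_def QuadRes_def)
qed

lemma Legendre_cases: "\<not> p dvd a \<Longrightarrow> Legendre a p = 1 \<or> Legendre a p = -1"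
  by (simp add: Legendre_def cong_0_iff)

text \<open>
By Euler's criterion the two sides agree modulo \<open>p\<close>; both lie in \<open>{-1, 0, 1}\<close>, and \<open>p > 2\<close>
separates these values.
\<close>

lemma Legendre_mult:
  assumes "prime p" "p > 2"
  shows "Legendre (a * b) (int p) = Legendre a (int p) * Legendre b (int p)"
proof -
  have "[Legendre (a * b) (int p) = (a * b) ^ ((p - 1) div 2)] (mod int p)"
    using assms by (rule euler_criterion)
  also have "(a * b) ^ ((p - 1) div 2) = a ^ ((p - 1) div 2) * b ^ ((p - 1) div 2)"
    by (rule power_mult_distrib)
  also have "[\<dots> = Legendre a (int p) * Legendre b (int p)] (mod int p)"
    using assms by (intro cong_mult cong_sym[OF euler_criterion])
  finally have "int p dvd Legendre (a * b) (int p) - Legendre a (int p) * Legendre b (int p)"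
    by (simp add: cong_iff_dvd_diff)
  moreover have "\<bar>Legendre (a * b) (int p) - Legendre a (int p) * Legendre b (int p)\<bar> < int p"
    using assms(2) by (auto simp: Legendre_def)
  ultimately show ?thesis
    using dvd_imp_le_int[of "Legendre (a * b) (int p) - Legendre a (int p) * Legendre b (int p)" "int p"]
    by linarith
qed

lemma Legendre_one: "prime p \<Longrightarrow> Legendre 1 (int p) = 1"
  unfolding Legendre_def QuadRes_def
  by (auto simp: cong_0_iff intro: exI[of _ 1])

text \<open>
Squaring modulo \<open>p\<close> is not injective, as \<open>1\<close> and \<open>p - 1\<close> have the same square, so on the finite set
of residues it is not surjective either.
\<close>

lemma nonresidue_exists:
  assumes "prime p" "p > 2"
  obtains a :: nat where "\<not> p dvd a" "Legendre (int a) (int p) = -1"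
proof -
  let ?sq = "\<lambda>y. y\<^sup>2 mod p"
  have "?sq 1 = ?sq (p - 1)"
  proof -
    have "int ((p - 1)\<^sup>2) = 1 + int p * (int p - 2)"
    proof -
      have "int (p - 1) = int p - 1" using assms(2) by simp
      then show ?thesis by (simp only: of_nat_power) (simp add: power2_eq_square algebra_simps)
    qed
    then have "[int ((p - 1)\<^sup>2) = int 1] (mod int p)" by (simp add: cong_iff_dvd_diff)
    then have "[(p - 1)\<^sup>2 = 1] (mod p)" by (simp only: cong_int_iff)
    then show ?thesis by (simp add: cong_def)
  qed
  then have "\<not> inj_on ?sq {..<p}" using assms(2) by (simp add: inj_on_def) (intro bexI[of _ 1] bexI[of _ "p - 1"]; simp)
  then have "?sq ` {..<p} \<noteq> {..<p}"
    by (metis card_image_le finite_lessThan inj_on_iff_eq_card order_refl)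
  moreover have "?sq ` {..<p} \<subseteq> {..<p}" using assms(2) by auto
  ultimately obtain a where a: "a < p" "a \<notin> ?sq ` {..<p}" by auto
  have "0 \<in> ?sq ` {..<p}" using assms(2) by (intro image_eqI[of _ _ 0]) auto
  then have "\<not> p dvd a" using a by (metis nat_dvd_not_less gr0I)
  moreover have "\<not> QuadRes (int p) (int a)"
  proof
    assume "QuadRes (int p) (int a)"
    then obtain y where y: "[y\<^sup>2 = int a] (mod int p)" by (auto simp: QuadRes_def)
    define z where "z = nat (y mod int p)"
    have z: "z < p" "int z = y mod int p" using assms(2) by (auto simp: z_def nat_less_iff)
    have "[int (z\<^sup>2) = int a] (mod int p)"
      using y by (simp add: z(2) cong_def power_mod)
    then have "?sq z = a" using a(1) by (simp only: cong_int_iff) (simp add: cong_def)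
    then show False using a(2) z(1) by blast
  qed
  ultimately show ?thesis using that[of a] by (simp add: Legendre_def cong_0_iff)
qed

definition Legendre_product :: "nat \<Rightarrow> nat set \<Rightarrow> nat \<Rightarrow> int" where
  "Legendre_product n D k = (if coprime k n then \<Prod>p\<in>D. Legendre (int k) (int p) else 0)"

lemma odd_prime_factor:
  fixes n p :: nat
  assumes "odd n" "p \<in> prime_factors n"
  shows "prime p" "p > 2"
proof -
  show p: "prime p" using assms(2) by (simp add: in_prime_factors_iff)
  have "odd p" using assms by (meson dvd_trans in_prime_factors_iff)
  then show "p > 2" using prime_ge_2_nat[OF p] by (cases "p = 2") auto
qed

lemma prod_signs:
  fixes f :: "'a \<Rightarrow> int"
  assumes "\<And>p. p \<in> D \<Longrightarrow> f p \<in> {1, -1}"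
  shows "prod f D \<in> {1, -1}"
  using assms
proof (induction D rule: infinite_finite_induct)
  case (insert x F)
  have "f x \<in> {1, -1}" "prod f F \<in> {1, -1}" using insert by blast+
  then show ?case using insert.hyps by auto
qed auto

lemma Legendre_product_in:
  assumes "odd n" "D \<subseteq> prime_factors n"
  shows "Legendre_product n D \<in> quadratic_characters n"
proof -
  have n: "n > 0" using assms(1) by (intro gr0I) auto
  have unit: "(\<Prod>p\<in>D. Legendre (int k) (int p)) \<in> {1, -1}" if "coprime k n" for k
  proof -
    have "Legendre (int k) (int p) \<in> {1, -1}" if "p \<in> D" for p
      using Legendre_cases[of "int p" "int k"] \<open>coprime k n\<close> that assms(2)
        coprime_iff_no_prime_factor[OF n, of k] by auto
    then show ?thesis by (rule prod_signs)
  qed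
  have mult: "(\<Prod>p\<in>D. Legendre (int (k * l)) (int p)) =
      (\<Prod>p\<in>D. Legendre (int k) (int p)) * (\<Prod>p\<in>D. Legendre (int l) (int p))" for k l
    unfolding prod.distrib[symmetric]
    using assms odd_prime_factor by (intro prod.cong refl) (auto simp: Legendre_mult subset_iff)
  have cong: "(\<Prod>p\<in>D. Legendre (int k) (int p)) = (\<Prod>p\<in>D. Legendre (int l) (int p))"
    if "[k = l] (mod n)" for k l
  proof (intro prod.cong refl Legendre_cong)
    fix p assume "p \<in> D"
    then have "p dvd n" using assms(2) by (auto simp: in_prime_factors_iff)
    then show "[int k = int l] (mod int p)"
      using that by (simp add: cong_int_iff cong_dvd_modulus_nat)
  qed
  show ?thesis
    unfolding quadratic_characters_def
  proof (intro CollectI conjI allI impI)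
    fix k l
    show "Legendre_product n D (k * l) = Legendre_product n D k * Legendre_product n D l"
      unfolding Legendre_product_def by (simp add: mult[simplified])
  next
    fix k l assume kl: "[k = l] (mod n)"
    show "Legendre_product n D k = Legendre_product n D l"
      unfolding Legendre_product_def using cong[OF kl] coprime_cong_cong_left[OF kl] by simp
  qed (use unit in \<open>simp_all add: Legendre_product_def\<close>)
qed

text \<open>
Arguments that are \<open>1\<close> modulo all prime divisors of \<open>n\<close> but \<open>p\<close> isolate the factor at \<open>p\<close>. At a nonresidue
modulo \<open>p\<close> they reveal whether \<open>p\<close> belongs to \<open>D\<close>.
\<close>

lemma Legendre_product_local:
  assumes "D \<subseteq> prime_factors n" "p \<in> prime_factors n" "coprime k n"
    "\<And>q. q \<in> prime_factors n \<Longrightarrow> q \<noteq> p \<Longrightarrow> [k = 1] (mod q)"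
  shows "Legendre_product n D k = (if p \<in> D then Legendre (int k) (int p) else 1)"
proof -
  have one: "Legendre (int k) (int q) = 1" if "q \<in> D" "q \<noteq> p" for q
  proof -
    have q: "q \<in> prime_factors n" using that assms(1) by auto
    have "[int k = int 1] (mod int q)" using assms(4)[OF q that(2)] by (simp only: cong_int_iff)
    then have "Legendre (int k) (int q) = Legendre 1 (int q)" by (simp add: Legendre_cong)
    then show ?thesis using q Legendre_one by (simp add: in_prime_factors_iff)
  qed
  have fin: "finite D" using assms(1) by (rule finite_subset) simp
  have "(\<Prod>q\<in>D. Legendre (int k) (int q)) = (\<Prod>q\<in>D. if q = p then Legendre (int k) (int p) else 1)"
    by (intro prod.cong refl) (auto simp: one)
  then show ?thesis using fin assms(3) by (simp add: Legendre_product_def)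
qed

lemma Legendre_product_inj:
  assumes "odd n" "D \<subseteq> prime_factors n" "E \<subseteq> prime_factors n"
    "Legendre_product n D = Legendre_product n E"
  shows "D = E"
proof -
  have n: "n > 0" using assms(1) by (intro gr0I) auto
  have "p \<in> D \<longleftrightarrow> p \<in> E" if p: "p \<in> prime_factors n" for p
  proof -
    obtain a where a: "\<not> p dvd a" "Legendre (int a) (int p) = -1"
      using nonresidue_exists[OF odd_prime_factor[OF assms(1) p]] .
    obtain k where k: "\<And>q. q \<in> prime_factors n \<Longrightarrow> [k = (if q = p then a else 1)] (mod q)"
      using crt_prime_factors[of n "\<lambda>q. if q = p then a else 1"] by blast
    have "coprime k n"
      unfolding coprime_iff_no_prime_factor[OF n]
    proof
      fix q assume q: "q \<in> prime_factors n"
      then have "prime q" by (simp add: in_prime_factors_iff)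
      then show "\<not> q dvd k"
        using cong_dvd_iff[OF k[OF q]] a(1) by (cases "q = p") auto
    qed
    moreover have "[k = 1] (mod q)" if "q \<in> prime_factors n" "q \<noteq> p" for q
      using k[OF that(1)] that(2) by simp
    ultimately have loc: "Legendre_product n F k = (if p \<in> F then Legendre (int k) (int p) else 1)"
      if "F \<subseteq> prime_factors n" for F
      using Legendre_product_local[OF that p] by blast
    have "[int k = int a] (mod int p)" using k[OF p] by (simp add: cong_int_iff)
    then have "Legendre (int k) (int p) = -1" using a(2) Legendre_cong by metis
    then show ?thesis using loc[OF assms(2)] loc[OF assms(3)] assms(4) by (auto split: if_splits)
  qed
  then show ?thesis using assms(2,3) by blast
qed

text \<open>
The Chinese remainder theorem writes a unit as a product of units, each of which is \<open>1\<close> modulo all prime divisors of \<open>n\<close>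
except one. On units supported at a prime \<open>p\<close> in this sense, a quadratic character is trivial on
quadratic residues, because these are squares modulo \<open>n\<close>; and all nonresidues lie in one class modulo squares. So there
it is either trivial or the Legendre symbol, and \<open>D\<close> collects the primes of the second kind.
\<close>

lemma Legendre_product_surj:
  assumes "odd n" "squarefree n" "\<chi> \<in> quadratic_characters n"
  obtains D where "D \<subseteq> prime_factors n" "\<chi> = Legendre_product n D"
proof -
  let ?P = "prime_factors n"
  have n: "n > 0" using assms(1) by (intro gr0I) auto
  note cop = coprime_iff_no_prime_factor[OF n]
  note \<chi> = quadratic_charactersD[OF assms(3)]
  define supported where "supported p k \<longleftrightarrow> coprime k n \<and> (\<forall>q\<in>?P - {p}. [k = 1] (mod q))" for p k
  define D where "D = {p \<in> ?P. \<exists>g. supported p g \<and> \<chi> g = -1}"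
  have square: "\<chi> k = 1" if p: "p \<in> ?P" and k: "supported p k" "Legendre (int k) (int p) = 1" for p k
  proof -
    have "QuadRes (int p) (int k)" using k(2) by (auto simp: Legendre_def split: if_splits)
    then obtain y where y: "[y\<^sup>2 = int k] (mod int p)" by (auto simp: QuadRes_def)
    have p0: "p > 0" using p by (simp add: in_prime_factors_iff prime_gt_0_nat)
    obtain x where x: "\<And>q. q \<in> ?P \<Longrightarrow> [x = (if q = p then nat (y mod int p) else 1)] (mod q)"
      using crt_prime_factors[of n "\<lambda>q. if q = p then nat (y mod int p) else 1"] by blast
    have "[x * x = k] (mod q)" if q: "q \<in> ?P" for q
    proof (cases "q = p")
      case True
      have "[x = nat (y mod int p)] (mod p)" using x[OF p] by simp
      then have "[int x = int (nat (y mod int p))] (mod int p)" by (simp only: cong_int_iff)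
      then have "[int x = y] (mod int p)" using p0 by (simp add: cong_def)
      then have "[int x * int x = y * y] (mod int p)" by (intro cong_mult)
      then have "[int (x * x) = int k] (mod int p)" using y by (simp add: power2_eq_square cong_trans)
      then show ?thesis unfolding True by (simp only: cong_int_iff)
    next
      case False
      then have "[x * x = 1 * 1] (mod q)" using x[OF q] by (intro cong_mult) auto
      then have "[x * x = 1] (mod q)" by simp
      moreover have "[k = 1] (mod q)" using k(1) q False by (simp add: supported_def)
      ultimately show ?thesis by (blast intro: cong_trans cong_sym)
    qed
    then have "[x * x = k] (mod n)" using squarefree_cong_iff[OF assms(2)] by blast
    then have "\<chi> k = \<chi> x * \<chi> x" using \<chi>(3,4) by metis
    moreover have "\<chi> k \<noteq> 0" using \<chi>(1)[of k] k(1) by (auto simp: supported_def)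
    ultimately have "\<chi> x = 1 \<or> \<chi> x = -1" using \<chi>(1,2)[of x] by auto
    then show ?thesis using \<open>\<chi> k = \<chi> x * \<chi> x\<close> by auto
  qed
  have nonzero: "\<not> int p dvd int k" if "p \<in> ?P" "supported p k" for p k
    using that cop by (auto simp: supported_def)
  have loc: "\<chi> k = (if p \<in> D then Legendre (int k) (int p) else 1)" if p: "p \<in> ?P" and k: "supported p k" for p k
  proof (cases "p \<in> D")
    case False
    then have "\<chi> k \<noteq> -1" using p k by (auto simp: D_def)
    then show ?thesis using False \<chi>(1)[of k] k by (auto simp: supported_def)
  next
    case True
    then obtain g where g: "supported p g" "\<chi> g = -1" by (auto simp: D_def)
    have gn: "Legendre (int g) (int p) = -1"
      using square[OF p g(1)] g(2) Legendre_cases[OF nonzero[OF p g(1)]] by auto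
    consider "Legendre (int k) (int p) = 1" | "Legendre (int k) (int p) = -1"
      using Legendre_cases[OF nonzero[OF p k]] by auto
    then show ?thesis
    proof cases
      case 1
      then show ?thesis using square[OF p k] True by simp
    next
      case 2
      have "supported p (k * g)"
        unfolding supported_def
      proof (intro conjI ballI)
        show "coprime (k * g) n" using k g by (simp add: supported_def)
        fix q assume "q \<in> ?P - {p}"
        then have "[k * g = 1 * 1] (mod q)" using k g unfolding supported_def by (intro cong_mult) auto
        then show "[k * g = 1] (mod q)" by simp
      qed
      moreover have "Legendre (int (k * g)) (int p) = 1"
        using Legendre_mult[OF odd_prime_factor[OF assms(1) p]] 2 gn by simp
      ultimately have "\<chi> (k * g) = 1" by (rule square[OF p])
      then show ?thesis using \<chi>(3)[of k g] g(2) 2 True by simp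
    qed
  qed
  have "\<chi> k = Legendre_product n D k" for k
  proof (cases "coprime k n")
    case True
    have "\<exists>c. supported p c \<and> [c = k] (mod p)" if p: "p \<in> ?P" for p
    proof -
      obtain c where c: "\<And>q. q \<in> ?P \<Longrightarrow> [c = (if q = p then k else 1)] (mod q)"
        using crt_prime_factors[of n "\<lambda>q. if q = p then k else 1"] by blast
      have "coprime c n"
        unfolding cop
      proof
        fix q assume q: "q \<in> ?P"
        then have "prime q" by (simp add: in_prime_factors_iff)
        then show "\<not> q dvd c"
          using cong_dvd_iff[OF c[OF q]] True q cop by (cases "q = p") auto
      qed
      moreover have "[c = 1] (mod q)" if "q \<in> ?P - {p}" for q using c[of q] that by simp
      ultimately show ?thesis using c[OF p] by (auto simp: supported_def)
    qed
    then obtain c where c: "\<And>p. p \<in> ?P \<Longrightarrow> supported p (c p)" "\<And>p. p \<in> ?P \<Longrightarrow> [c p = k] (mod p)"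
      by metis
    have "[(\<Prod>p\<in>?P. c p) = k] (mod q)" if q: "q \<in> ?P" for q
    proof -
      have "(\<Prod>p\<in>?P. c p) = c q * (\<Prod>p\<in>?P - {q}. c p)" using q by (simp add: prod.remove)
      moreover have "[c q * (\<Prod>p\<in>?P - {q}. c p) = k * (\<Prod>p\<in>?P - {q}. 1)] (mod q)"
        using c q by (intro cong_mult cong_prod) (auto simp: supported_def)
      ultimately show ?thesis by simp
    qed
    then have "[(\<Prod>p\<in>?P. c p) = k] (mod n)" using squarefree_cong_iff[OF assms(2)] by blast
    then have "\<chi> k = \<chi> (\<Prod>p\<in>?P. c p)" using \<chi>(4) by metis
    also have "\<dots> = (\<Prod>p\<in>?P. \<chi> (c p))"
    proof -
      have "\<chi> (prod c A) = (\<Prod>p\<in>A. \<chi> (c p))" for A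
        using quadratic_character_one[OF assms(3)] by (induction A rule: infinite_finite_induct) (auto simp: \<chi>(3))
      then show ?thesis .
    qed
    also have "\<dots> = (\<Prod>p\<in>?P. if p \<in> D then Legendre (int k) (int p) else 1)"
    proof (intro prod.cong refl)
      fix p assume p: "p \<in> ?P"
      have "Legendre (int (c p)) (int p) = Legendre (int k) (int p)"
        using c(2)[OF p] by (intro Legendre_cong) (simp add: cong_int_iff)
      then show "\<chi> (c p) = (if p \<in> D then Legendre (int k) (int p) else 1)"
        using loc[OF p c(1)[OF p]] by simp
    qed
    also have "\<dots> = (\<Prod>p\<in>?P \<inter> D. Legendre (int k) (int p))"
      by (simp add: prod.inter_restrict)
    also have "?P \<inter> D = D" by (auto simp: D_def)
    finally show ?thesis using True by (simp add: Legendre_product_def)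
  qed (simp add: \<chi>(2) Legendre_product_def)
  moreover have "D \<subseteq> ?P" by (auto simp: D_def)
  ultimately show ?thesis using that[of D] by auto
qed

lemma card_quadratic_characters:
  assumes "odd n" "squarefree n"
  shows "card (quadratic_characters n) = 2 ^ card (prime_factors n)"
proof -
  have "bij_betw (Legendre_product n) (Pow (prime_factors n)) (quadratic_characters n)"
  proof (rule bij_betw_imageI)
    show "inj_on (Legendre_product n) (Pow (prime_factors n))"
      using Legendre_product_inj[OF assms(1)] by (auto simp: inj_on_def)
    show "Legendre_product n ` Pow (prime_factors n) = quadratic_characters n"
      using Legendre_product_in[OF assms(1)] by (auto elim: Legendre_product_surj[OF assms])
  qed
  then have "card (Pow (prime_factors n)) = card (quadratic_characters n)"
    by (rule bij_betw_same_card)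
  then show ?thesis by (simp add: card_Pow)
qed

lemma card_nonprincipal_characters:
  assumes "odd n" "squarefree n"
  shows "1 + card (quadratic_characters n - {principal_character n}) = 2 ^ card (prime_factors n)"
proof -
  have "principal_character n \<in> quadratic_characters n"
    using coprime_cong_cong_left by (auto simp: quadratic_characters_def principal_character_def)
  moreover have "finite (quadratic_characters n)"
    by (rule card_ge_0_finite) (simp add: card_quadratic_characters[OF assms])
  ultimately show ?thesis
    by (simp add: card_quadratic_characters[OF assms])
qed

theorem theorem5p1:
  fixes n m :: nat
  assumes "n > 0" and "squarefree n" and "odd n"
    and "m > 0" and "n dvd m"
  shows "card (rng_hom (ZFact (int m)) (ZFact (int n))) =
         1 + card (quadratic_subfields (cyclotomic_field n))"
proof -
  interpret primitive_root_of_unity n "cis (2 * pi / real n)"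
    by (rule primitive_root_cis[OF \<open>n > 0\<close>])
  have "card (quadratic_subfields (cyclotomic_field n)) = card (quadratic_characters n - {principal_character n})"
    unfolding cyclotomic_field_def generate_field_eq_L
    using bij_betw_same_card[OF bij_betw_characters_quadratic_subfields] by simp
  moreover have "card (rng_hom (ZFact (int m)) (ZFact (int n))) = 2 ^ card (prime_factors n)"
    using bij_betw_same_card[OF bij_betw_idempotents_rng_hom[OF \<open>n > 0\<close> \<open>m > 0\<close> \<open>n dvd m\<close>]]
      card_idempotents[OF \<open>squarefree n\<close>] by simp
  ultimately show ?thesis
    using card_nonprincipal_characters[OF \<open>odd n\<close> \<open>squarefree n\<close>] by simp
qed

end
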